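(* Let $q=2^h$ and let $\lambda$ be a primitive element of $\mathbb{F}_q$ whose minimal polynomial over $\mathbb{F}_2$ has the form $x^h+c_{h-3}x^{h-3}+\dots+c_1x+c_0$. Write $\mu=\sum_{i=0}^{h-1}\mu_i\lambda^i$, $\mu_i\in\mathbb{F}_2$, and let $\mathcal{A}_0=S_A\cup S_B\cup S_{C,0}\cup S_{D,0}\cup S_{E,0}\subseteq\mathrm{PG}(2,q)$ where $S_A=\{(\mu,1,0)\mid \mu_{h-2}=0,\mu_{h-3}=1\}$, $S_B=\{(\mu,0,1)\mid \mu_{h-1}=0,\mu_{h-2}=1\}$, $S_{C,0}=\{(\mu,1,1)\mid \mu_{h-2}=0,\sum_{i=0}^{h-3}\mu_i=0\}$, $S_{D,0}=\{(\mu,\lambda,1)\mid \mu_{h-1}+\mu_{h-2}=1,\sum_{i=0}^{h-3}\mu_i=0\}$, $S_{E,0}=\{(\mu,\lambda^2,1)\mid \mu_{h-1}=0,\sum_{i=0}^{h-2}\mu_i=0\}$ (a translation KM-arc of type $q/4$ with nucleus $N=(1,0,0)$ and translation line $\ell: Y=\lambda Z$). Then the set consisting of $N$ and the points of $\ell$ not in $\mathcal{A}_0$, viewed in $\mathrm{PG}(1,q)$ via the identification $(x,\lambda z,z)\mapsto(x,z)$, is $\mathrm{PGL}(2,q)$-equivalent to the $\mathbb{F}_2$-linear $(h-2)$-club of rank $h$ $$\mathcal{C}=\{\langle(t_1\lambda+\dots+t_{h-1}\lambda^{h-1},\ t_{h-1}+t_h\lambda)\rangle_{\mathbb{F}_q}: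 t_i\in\mathbb{F}_2,\ (t_1,\dots,t_h)\neq 0\}.$$
   Context: Points of $\mathrm{PG}(2,q)$ are given by homogeneous coordinates $(X,Y,Z)$. A KM-arc of type $t$ is a set of $q+t$ points such that each line meets it in $0$, $2$ or $t$ points, each value occurring; its nucleus is the common point of its $t$-secants. An $\mathbb{F}_2$-linear set of rank $k$ in $\mathrm{PG}(1,q)$ is the set of points defined by the nonzero vectors of a $k$-dimensional $\mathbb{F}_2$-subspace $W$ of $\mathbb{F}_q^2$; the weight of a point $\langle v\rangle$ is $\dim_{\mathbb{F}_2}(W\cap\langle v\rangle_{\mathbb{F}_q})$; an $i$-club of rank $k$ is such a set with one point (the head) of weight $i$ and all others of weight $1$. *)

theory Defs
  imports
    "HOL-Analysis.Analysis"
    "HOL-Computational_Algebra.Polynomial"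
    "HOL-Library.Z2"
begin

section \<open>Points, lines and projectivities\<close>

text \<open>PG(n-1,q) is the lattice of linear subspaces of \<^typ>\<open>'a::field ^ 'n\<close>, where q is the
  cardinality of the field: points have (vector space) dimension 1, lines dimension 2, and
  incidence is inclusion. In particular \<^typ>\<open>'a::field ^ 3\<close> gives PG(2,q) and
  \<^typ>\<open>'a::field ^ 2\<close> gives PG(1,q).\<close>

definition pg_points :: "('a::field ^ 'n) set set" where
  "pg_points = {P. vec.subspace P \<and> vec.dim P = 1}"

definition pg_lines :: "('a::field ^ 'n) set set" where
  "pg_lines = {L. vec.subspace L \<and> vec.dim L = 2}"

definition pt :: "'a::field ^ 'n \<Rightarrow> ('a ^ 'n) set" where
  "pt v = vec.span {v}"

definition points_on :: "('a::field ^ 'n) set \<Rightarrow> ('a ^ 'n) set set" where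
  "points_on L = {P \<in> pg_points. P \<subseteq> L}"

definition pgl_map :: "'a::field ^ 'n ^ 'n \<Rightarrow> ('a ^ 'n) set \<Rightarrow> ('a ^ 'n) set" where
  "pgl_map M U = (\<lambda>v. M *v v) ` U"

definition pgl_equivalent :: "('a::field ^ 'n) set set \<Rightarrow> ('a ^ 'n) set set \<Rightarrow> bool" where
  "pgl_equivalent S T \<longleftrightarrow> (\<exists>M :: 'a ^ 'n ^ 'n. invertible M \<and> pgl_map M ` S = T)"


section \<open>KM-arcs\<close>

definition km_arc :: "nat \<Rightarrow> ('a::{field,finite} ^ 3) set set \<Rightarrow> bool" where
  "km_arc t A \<longleftrightarrow> A \<subseteq> pg_points \<and> card A = CARD('a) + t \<and>
     (\<forall>L \<in> pg_lines. card (A \<inter> points_on L) \<in> {0, 2, t}) \<and>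
     (\<forall>n \<in> {0, 2, t}. \<exists>L \<in> pg_lines. card (A \<inter> points_on L) = n)"

definition nucleus :: "nat \<Rightarrow> ('a::{field,finite} ^ 3) set set \<Rightarrow> ('a ^ 3) set \<Rightarrow> bool" where
  "nucleus t A N \<longleftrightarrow>
     (\<forall>P \<in> pg_points. (\<forall>L \<in> pg_lines. card (A \<inter> points_on L) = t \<longrightarrow> P \<subseteq> L) \<longleftrightarrow> P = N) \<and>
     N \<in> pg_points"

text \<open>An elation with axis \<open>L\<close> fixes all points of \<open>L\<close> and all lines through some centre on \<open>L\<close>.
  The identity is included. Since every such collineation is induced by a linear map, it is
  enough to consider matrices.\<close>

definition elation :: "('a::field ^ 3) set \<Rightarrow> 'a ^ 3 ^ 3 \<Rightarrow> bool" where
  "elation L M \<longleftrightarrow> invertible M \<and> (\<forall>P \<in> points_on L. pgl_map M P = P) \<and>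
     (\<exists>C \<in> points_on L. \<forall>L' \<in> pg_lines. C \<subseteq> L' \<longrightarrow> pgl_map M L' = L')"

text \<open>The elations with axis \<open>L\<close> stabilising \<open>A\<close> act transitively on the points of \<open>A\<close> off \<open>L\<close>.\<close>

definition translation_line :: "('a::field ^ 3) set set \<Rightarrow> ('a ^ 3) set \<Rightarrow> bool" where
  "translation_line A L \<longleftrightarrow> L \<in> pg_lines \<and>
     (\<forall>P \<in> A - points_on L. \<forall>Q \<in> A - points_on L.
        \<exists>M. elation L M \<and> pgl_map M ` A = A \<and> pgl_map M P = Q)"


section \<open>The field with two elements and linear sets\<close>

text \<open>\<^typ>\<open>bit\<close> is the field with two elements; \<^term>\<open>of_bit\<close> embeds it into any field of
  characteristic 2, which is the only situation in which the notions below are used.\<close>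

definition f2_scale :: "bit \<Rightarrow> 'a::field ^ 'n \<Rightarrow> 'a ^ 'n" where
  "f2_scale b v = of_bit b *s v"

lemma two_eq_0_if_card_power_2:
  assumes "CARD('a::{field,finite}) = 2 ^ h"
  shows "(2::'a) = 0"
proof -
  have "(\<Sum>x\<in>UNIV. x + (1::'a)) = (\<Sum>x\<in>UNIV. x)"
    by (rule sum.reindex_bij_witness[where i = "\<lambda>x. x - 1" and j = "\<lambda>x. x + 1"]) auto
  then have "of_nat CARD('a) = (0::'a)"
    by (simp add: sum.distrib)
  then show ?thesis
    using assms by simp
qed

lemma vector_space_f2_scale:
  assumes "(2::'a::field) = 0"
  shows "vector_space (f2_scale :: bit \<Rightarrow> 'a ^ 'n \<Rightarrow> 'a ^ 'n)"
proof
  fix a b :: bit and x y :: "'a ^ 'n"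
  have *: "v + v = 0" for v :: 'a
    using assms by (metis mult_2 mult_zero_left)
  show "f2_scale a (x + y) = f2_scale a x + f2_scale a y"
    by (simp add: f2_scale_def vec_eq_iff)
  show "f2_scale (a + b) x = f2_scale a x + f2_scale b x"
    by (cases a; cases b) (simp_all add: f2_scale_def vec_eq_iff assms *)
  show "f2_scale a (f2_scale b x) = f2_scale (a * b) x"
    by (cases a; cases b) (simp_all add: f2_scale_def vec_eq_iff)
  show "f2_scale 1 x = x"
    by (simp add: f2_scale_def vec_eq_iff)
qed

abbreviation f2_subspace :: "('a::field ^ 'n) set \<Rightarrow> bool" where
  "f2_subspace \<equiv> module.subspace f2_scale"

abbreviation f2_dim :: "('a::field ^ 'n) set \<Rightarrow> nat" where
  "f2_dim \<equiv> vector_space.dim f2_scale"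

definition linear_set :: "('a::field ^ 2) set \<Rightarrow> ('a ^ 2) set set" where
  "linear_set W = {pt w | w. w \<in> W \<and> w \<noteq> 0}"

definition weight :: "('a::field ^ 2) set \<Rightarrow> ('a ^ 2) set \<Rightarrow> nat" where
  "weight W P = f2_dim (W \<inter> P)"

definition f2_club :: "nat \<Rightarrow> nat \<Rightarrow> ('a::field ^ 2) set set \<Rightarrow> bool" where
  "f2_club i k S \<longleftrightarrow> (\<exists>W. f2_subspace W \<and> f2_dim W = k \<and> S = linear_set W \<and>
     (\<exists>H \<in> S. weight W H = i \<and> (\<forall>P \<in> S - {H}. weight W P = 1)))"


section \<open>Primitive elements and minimal polynomials\<close>

definition primitive_element :: "'a::field \<Rightarrow> bool" where
  "primitive_element x \<longleftrightarrow> {x ^ k | k::nat. True} = UNIV - {0}"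

definition f2_minpoly :: "'a::field \<Rightarrow> bit poly \<Rightarrow> bool" where
  "f2_minpoly x p \<longleftrightarrow> lead_coeff p = 1 \<and> poly (map_poly of_bit p) x = 0 \<and>
     (\<forall>r. r \<noteq> 0 \<and> poly (map_poly of_bit r) x = 0 \<longrightarrow> degree p \<le> degree r)"


section \<open>The arc and the club\<close>

text \<open>\<open>from_coords h x m\<close> is the field element with coordinates m 0, ..., m (h - 1) with respect
  to the powers of x. The five sets below range over all coordinate vectors; those are in
  bijection with the field elements when x has degree h over the prime field.\<close>

definition from_coords :: "nat \<Rightarrow> 'a::field \<Rightarrow> (nat \<Rightarrow> bit) \<Rightarrow> 'a" where
  "from_coords h x m = (\<Sum>i<h. of_bit (m i) * x ^ i)"

definition S_A :: "nat \<Rightarrow> 'a::field \<Rightarrow> ('a ^ 3) set set" where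
  "S_A h x = {pt (vector [from_coords h x m, 1, 0]) | m. m (h - 2) = 0 \<and> m (h - 3) = 1}"

definition S_B :: "nat \<Rightarrow> 'a::field \<Rightarrow> ('a ^ 3) set set" where
  "S_B h x = {pt (vector [from_coords h x m, 0, 1]) | m. m (h - 1) = 0 \<and> m (h - 2) = 1}"

definition S_C0 :: "nat \<Rightarrow> 'a::field \<Rightarrow> ('a ^ 3) set set" where
  "S_C0 h x = {pt (vector [from_coords h x m, 1, 1]) | m.
     m (h - 2) = 0 \<and> (\<Sum>i=0..h-3. m i) = 0}"

definition S_D0 :: "nat \<Rightarrow> 'a::field \<Rightarrow> ('a ^ 3) set set" where
  "S_D0 h x = {pt (vector [from_coords h x m, x, 1]) | m.
     m (h - 1) + m (h - 2) = 1 \<and> (\<Sum>i=0..h-3. m i) = 0}"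

definition S_E0 :: "nat \<Rightarrow> 'a::field \<Rightarrow> ('a ^ 3) set set" where
  "S_E0 h x = {pt (vector [from_coords h x m, x\<^sup>2, 1]) | m.
     m (h - 1) = 0 \<and> (\<Sum>i=0..h-2. m i) = 0}"

definition arc_A0 :: "nat \<Rightarrow> 'a::field \<Rightarrow> ('a ^ 3) set set" where
  "arc_A0 h x = S_A h x \<union> S_B h x \<union> S_C0 h x \<union> S_D0 h x \<union> S_E0 h x"

definition pt_N :: "('a::field ^ 3) set" where
  "pt_N = pt (vector [1, 0, 0])"

definition line_l :: "'a::field \<Rightarrow> ('a ^ 3) set" where
  "line_l x = {v. v $ 2 = x * v $ 3}"

text \<open>Only applied to points on \<open>line_l x\<close>, where it is the identification
  (X, x Z, Z) to (X, Z).\<close>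

definition to_PG1 :: "('a::field ^ 3) set \<Rightarrow> ('a ^ 2) set" where
  "to_PG1 P = (\<lambda>v. vector [v $ 1, v $ 3]) ` P"

definition club_C :: "nat \<Rightarrow> 'a::field \<Rightarrow> ('a ^ 2) set set" where
  "club_C h x =
     {pt (vector [\<Sum>i=1..h-1. of_bit (t i) * x ^ i, of_bit (t (h - 1)) + of_bit (t h) * x]) | t.
        \<exists>i \<in> {1..h}. t i \<noteq> (0::bit)}"

end

theory Submission
  imports Defs
begin

text \<open>
  A line not through \<open>N\<close> has an equation \<open>X = a Y + b Z\<close>; it meets the five lines through
  \<open>N\<close> that carry the arc in the points with \<open>X\<close>-coordinates \<open>a\<close>, \<open>b\<close>, \<open>a + b\<close>,
  \<open>\<lambda> a + b\<close> and \<open>\<lambda>\<^sup>2 a + b\<close>. The shape of the minimal polynomial makes multiplication by \<open>\<lambda>\<close>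
  act on a few \<open>GF(2)\<close>-linear functionals by shifting: the top coordinates are shifted because the
  coefficients of degrees \<open>h - 1\<close> and \<open>h - 2\<close> vanish, coordinate 0 because the constant coefficient
  is 1, and the sum of the coordinates up to \<open>h - 3\<close> because the lower coefficients sum to 0.
  Whether the five points lie in the arc thus depends on six bits, and a case distinction
  gives 0 or 2 incidences. The elations with axis \<open>\<ell>\<close> form a group isomorphic to \<open>GF(q)^2\<close>;
  the parameters \<open>(\<alpha>, 0)\<close> with two vanishing coordinates of \<open>\<alpha>\<close>, \<open>(0, 1/\<lambda>)\<close> and
  \<open>(\<lambda>^(h - 3), 1/(1 + \<lambda>))\<close> stabilise the arc and already act transitively off \<open>\<ell>\<close>. Finally, both
  the club and the complement of the arc on \<open>\<ell>\<close> miss an affine subspace of codimension 2,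
  and an affine map \<open>x \<mapsto> \<lambda> x / (1 + \<lambda>) + \<lambda>^(h - 2)\<close> takes one to the other.
\<close>

section \<open>Vector spaces over finite fields and additive functionals\<close>

text \<open>Every vector of \<open>span (insert b B)\<close> splits uniquely as a multiple of
  \<open>b\<close> plus a vector of \<open>span B\<close>, so each basis vector multiplies the
  cardinality by the size of the field.\<close>

lemma (in vector_space) card_span_independent:
  assumes "finite B" "independent B"
  shows "card (span B) = CARD('a) ^ card B"
  using assms
proof (induction B)
  case empty
  then show ?case by (simp add: span_empty)
next
  case (insert b B)
  have B: "independent B" "b \<notin> span B"
    using insert.prems insert.hyps by (auto simp: independent_insert)
  have "bij_betw (\<lambda>(k, v). scale k b + v) (UNIV \<times> span B) (span (insert b B))"
  proof (rule bij_betwI')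
    fix p p' :: "'a \<times> 'b" assume p: "p \<in> UNIV \<times> span B" "p' \<in> UNIV \<times> span B"
    obtain k v k' v' where e: "p = (k, v)" "p' = (k', v')" by fastforce
    show "((case p of (k, v) \<Rightarrow> scale k b + v) = (case p' of (k, v) \<Rightarrow> scale k b + v)) = (p = p')"
    proof
      assume "(case p of (k, v) \<Rightarrow> scale k b + v) = (case p' of (k, v) \<Rightarrow> scale k b + v)"
      then have eq: "scale (k - k') b = v' - v"
        using e by (simp add: scale_left_diff_distrib algebra_simps)
      have "k = k'"
      proof (rule ccontr)
        assume "k \<noteq> k'"
        have "scale (k - k') b \<in> span B"
          unfolding eq using p e by (simp add: span_diff)
        then have "scale (inverse (k - k')) (scale (k - k') b) \<in> span B"
          by (rule span_scale)
        with \<open>k \<noteq> k'\<close> B(2) show False by simp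
      qed
      with eq e show "p = p'" by simp
    qed simp
  next
    fix p :: "'a \<times> 'b" assume "p \<in> UNIV \<times> span B"
    then show "(case p of (k, v) \<Rightarrow> scale k b + v) \<in> span (insert b B)"
      by (cases p) (auto simp: span_breakdown_eq intro!: exI[of _ "fst p"])
  next
    fix w assume "w \<in> span (insert b B)"
    then obtain k where "w - scale k b \<in> span B"
      by (auto simp: span_breakdown_eq)
    then show "\<exists>p\<in>UNIV \<times> span B. w = (case p of (k, v) \<Rightarrow> scale k b + v)"
      by (intro bexI[of _ "(k, w - scale k b)"]) auto
  qed
  then have "card (span (insert b B)) = card ((UNIV :: 'a set) \<times> span B)"
    by (rule bij_betw_same_card[symmetric])
  then show ?case
    using insert B by (simp add: card_cartesian_product)
qed

lemma (in vector_space) card_subspace: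
  assumes "subspace V" "finite V"
  shows "card V = CARD('a) ^ dim V"
proof -
  obtain B where B: "B \<subseteq> V" "independent B" "V \<subseteq> span B" "card B = dim V"
    by (rule basis_exists)
  then have "span B = V"
    using assms(1) span_subspace by blast
  with B assms(2) show ?thesis
    using card_span_independent[of B] finite_subset by metis
qed

lemma card_bit: "CARD(bit) = 2"
proof -
  have "(UNIV :: bit set) = {0, 1}"
    by (auto intro: bit_not_one_iff[THEN iffD1])
  then show ?thesis by (metis card_2_iff zero_neq_one)
qed

text \<open>Dimensions over \<open>GF(2)\<close> are found by counting vectors; this serves for the
  rank and the weights of the club.\<close>

lemma f2_dim_eqI:
  fixes V :: "('a::{field,finite} ^ 'n) set"
  assumes "(2::'a) = 0" "f2_subspace V" "card V = 2 ^ n"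
  shows "f2_dim V = n"
proof -
  interpret f2: vector_space "f2_scale :: bit \<Rightarrow> 'a ^ 'n \<Rightarrow> 'a ^ 'n"
    by (rule vector_space_f2_scale) fact
  show ?thesis
    using f2.card_subspace[of V] assms card_bit by simp
qed

text \<open>The only scalars are 0 and 1, so closure under scaling comes for free.\<close>

lemma f2_subspaceI:
  fixes V :: "('a::field ^ 'n) set"
  assumes "(2::'a) = 0" "0 \<in> V" "\<And>v w. v \<in> V \<Longrightarrow> w \<in> V \<Longrightarrow> v + w \<in> V"
  shows "f2_subspace V"
proof -
  interpret f2: vector_space "f2_scale :: bit \<Rightarrow> 'a ^ 'n \<Rightarrow> 'a ^ 'n"
    by (rule vector_space_f2_scale) fact
  have "f2_scale k v \<in> V" if "v \<in> V" for k v
    using that assms by (cases k) (simp_all add: f2_scale_def)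
  then show ?thesis
    using assms by (simp add: f2.subspace_def)
qed

lemma subspace_dim_eqI:
  fixes V :: "('a::{field,finite} ^ 'n) set"
  assumes "vec.subspace V" "card V = CARD('a) ^ n"
  shows "vec.dim V = n"
proof -
  have "CARD('a) \<ge> 2"
    by (metis card_2_iff card_mono finite_class.finite_UNIV subset_UNIV zero_neq_one)
  then show ?thesis
    using vec.card_subspace[OF assms(1)] assms(2) by simp
qed

text \<open>Truth values in place of bits make goals about coordinates propositional.\<close>

definition xor_additive :: "('a::plus \<Rightarrow> bool) \<Rightarrow> bool" where
  "xor_additive f \<longleftrightarrow> (\<forall>a b. f (a + b) \<longleftrightarrow> f a \<noteq> f b)"

lemma xor_additiveD: "xor_additive f \<Longrightarrow> f (a + b) \<longleftrightarrow> f a \<noteq> f b"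
  by (simp add: xor_additive_def)

text \<open>The pair \<open>(f, g)\<close> is a homomorphism onto \<open>GF(2)^2\<close>:
  translation by \<open>u\<close> flips \<open>f\<close> alone and translation by \<open>v\<close>
  flips \<open>g\<close> alone, so all four fibres have the same size.\<close>

lemma card_quarter:
  fixes f g :: "'a::{field,finite} \<Rightarrow> bool"
  assumes f: "xor_additive f" and g: "xor_additive g"
    and u: "f u" "\<not> g u" and v: "\<not> f v" "g v"
  shows "card {a. f a = i \<and> g a = j} = CARD('a) div 4"
proof -
  define X where "X i j = {a. f a = i \<and> g a = j}" for i j
  have "card (X i j) = card (X (i \<noteq> f w) (j \<noteq> g w))" for i j w
  proof (rule bij_betw_same_card[of "\<lambda>a. a + w"], rule bij_betwI[where g = "\<lambda>a. a - w"])
    have f': "f (a - w) \<longleftrightarrow> f a \<noteq> f w" "g (a - w) \<longleftrightarrow> g a \<noteq> g w" for a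
      using xor_additiveD[OF f, of "a - w" w] xor_additiveD[OF g, of "a - w" w] by auto
    show "(\<lambda>a. a - w) \<in> X (i \<noteq> f w) (j \<noteq> g w) \<rightarrow> X i j"
      by (auto simp: X_def f')
  qed (auto simp: X_def xor_additiveD[OF f] xor_additiveD[OF g])
  from this[of _ _ u] this[of _ _ v] u v
  have e: "card (X i j) = card (X (\<not> i) j)" "card (X i j) = card (X i (\<not> j))" for i j
    by auto
  have all: "card (X i' j') = card (X i j)" for i j i' j'
  proof -
    have "card (X i' j') = card (X i j')"
      using e(1)[of i j'] by (cases i; cases i') simp_all
    also have "\<dots> = card (X i j)"
      using e(2)[of i j] by (cases j; cases j') simp_all
    finally show ?thesis .
  qed
  have "CARD('a) = card ((X True True \<union> X True False) \<union> (X False True \<union> X False False))"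
    by (rule arg_cong[of _ _ card]) (auto simp: X_def)
  also have "\<dots> = card (X True True \<union> X True False) + card (X False True \<union> X False False)"
    by (rule card_Un_disjoint) (auto simp: X_def)
  also have "card (X True True \<union> X True False) = card (X True True) + card (X True False)"
    by (rule card_Un_disjoint) (auto simp: X_def)
  also have "card (X False True \<union> X False False) = card (X False True) + card (X False False)"
    by (rule card_Un_disjoint) (auto simp: X_def)
  finally have "CARD('a) = 4 * card (X i j)"
    using all[of True True i j] all[of True False i j] all[of False True i j] all[of False False i j]
    by linarith
  then show ?thesis
    by (simp add: X_def)
qed

lemma card_half:
  fixes f :: "'a::{field,finite} \<Rightarrow> bool"
  assumes f: "xor_additive f" and u: "f u"
  shows "2 * card {a. \<not> f a} = CARD('a)"
proof -
  have "card {a. \<not> f a} = card {a. f a}"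
  proof (rule bij_betw_same_card[of "\<lambda>a. a + u"], rule bij_betwI[where g = "\<lambda>a. a - u"])
    have "f (a - u) \<longleftrightarrow> f a \<noteq> f u" for a
      using xor_additiveD[OF f, of "a - u" u] by auto
    then show "(\<lambda>a. a - u) \<in> {a. f a} \<rightarrow> {a. \<not> f a}"
      using u by auto
  qed (use xor_additiveD[OF f] u in auto)
  moreover have "CARD('a) = card {a. \<not> f a} + card {a. f a}"
    by (subst card_Un_disjoint[symmetric]) (auto intro: arg_cong[of _ _ card])
  ultimately show ?thesis by simp
qed

lemma of_bit_add:
  assumes "(2::'a::field) = 0"
  shows "(of_bit (a + b) :: 'a) = of_bit a + of_bit b"
  using assms by (cases a; cases b) simp_all

lemma uminus_eq_self:
  assumes "(2::'a::field) = 0"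
  shows "- x = (x::'a)"
  using assms by (metis add.inverse_unique mult_2 mult_zero_left)

lemma poly_of_bit:
  assumes "degree p \<le> n"
  shows "poly (map_poly of_bit p) (x::'a::field) = (\<Sum>i\<le>n. of_bit (coeff p i) * x ^ i)"
proof -
  have "poly (map_poly of_bit p) x = (\<Sum>i\<le>n. coeff (map_poly of_bit p) i * x ^ i)"
  proof (subst poly_altdef, rule sum.mono_neutral_left)
    show "{..degree (map_poly of_bit p :: 'a poly)} \<subseteq> {..n}"
      using map_poly_degree_leq[of "of_bit :: bit \<Rightarrow> 'a" p] assms
      unfolding atMost_subset_iff by (rule order_trans)
  qed (auto simp: coeff_eq_0 not_le)
  then show ?thesis
    by (simp add: coeff_map_poly)
qed

lemma bit_add_eq_1_iff: "(a :: bit) + b = 1 \<longleftrightarrow> (a = 1) \<noteq> (b = 1)"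
  by (cases a; cases b) simp_all

section \<open>Points and lines of PG(2,q)\<close>

lemma pt_iff: "w \<in> pt v \<longleftrightarrow> (\<exists>k. w = k *s v)"
  by (auto simp: pt_def vec.span_singleton)

lemma subspace_pt: "vec.subspace (pt v)"
  by (simp add: pt_def)

lemma self_in_pt: "v \<in> pt v"
  by (simp add: pt_def vec.span_base)

lemma pt_subset_iff: "vec.subspace L \<Longrightarrow> pt v \<subseteq> L \<longleftrightarrow> v \<in> L"
  using self_in_pt vec.span_minimal[of "{v}" L] by (auto simp: pt_def)

lemma pt_in_pg_points: "v \<noteq> 0 \<Longrightarrow> pt v \<in> pg_points"
  using vec.dim_eq_card_independent[of "{v}"] by (simp add: pg_points_def pt_def)

lemma pg_points_cases:
  assumes "P \<in> pg_points"
  obtains v where "v \<noteq> 0" "P = pt v"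
proof -
  have P: "vec.subspace P" "vec.dim P = 1"
    using assms by (auto simp: pg_points_def)
  obtain B where B: "B \<subseteq> P" "vec.independent B" "P \<subseteq> vec.span B" "card B = vec.dim P"
    by (rule vec.basis_exists)
  then obtain v where v: "B = {v}"
    using P by (auto simp: card_1_singleton_iff)
  have "P = vec.span B"
    using B P vec.span_minimal by blast
  with v B(2) show ?thesis
    by (intro that[of v]) (auto simp: pt_def)
qed

lemma pt_scale: "k \<noteq> 0 \<Longrightarrow> pt (k *s v) = pt v"
proof -
  assume "k \<noteq> 0"
  have "v \<in> pt (k *s v)"
    unfolding pt_iff using \<open>k \<noteq> 0\<close> by (intro exI[of _ "inverse k"]) simp
  moreover have "k *s v \<in> pt v"
    unfolding pt_iff by blast
  ultimately show ?thesis
    by (simp add: set_eq_subset pt_subset_iff subspace_pt)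
qed

lemma pt_eq_iff: "v \<noteq> 0 \<Longrightarrow> pt v = pt w \<longleftrightarrow> (\<exists>k. k \<noteq> 0 \<and> v = k *s w)"
proof -
  assume "v \<noteq> 0"
  have "\<exists>k. k \<noteq> 0 \<and> v = k *s w" if "pt v = pt w"
  proof -
    have "v \<in> pt w"
      using self_in_pt[of v] that by simp
    then obtain k where "v = k *s w"
      by (auto simp: pt_iff)
    with \<open>v \<noteq> 0\<close> show ?thesis by auto
  qed
  then show ?thesis
    by (auto simp: pt_scale)
qed

lemma pgl_map_pt: "pgl_map M (pt v) = pt (M *v v)"
  by (force simp: pgl_map_def pt_iff set_eq_iff image_iff vector_scalar_commute)

lemma vec3_eq_iff: "(v :: 'a ^ 3) = w \<longleftrightarrow> v $ 1 = w $ 1 \<and> v $ 2 = w $ 2 \<and> v $ 3 = w $ 3"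
  by (simp add: vec_eq_iff forall_3)

lemma vec2_eq_iff: "(v :: 'a ^ 2) = w \<longleftrightarrow> v $ 1 = w $ 1 \<and> v $ 2 = w $ 2"
  by (simp add: vec_eq_iff forall_2)

text \<open>A point other than \<open>N\<close> is given by its \<open>X\<close>-coordinate and the direction \<open>(Y, Z)\<close>,
  normalised so that the last nonzero entry is 1. Lines through \<open>N\<close> are an \<open>nline\<close>, all other lines
  an \<open>xline\<close>.\<close>

definition normal_dir :: "'a::field \<Rightarrow> 'a \<Rightarrow> bool" where
  "normal_dir y z \<longleftrightarrow> z = 1 \<or> z = 0 \<and> y = 1"

text \<open>The left side is incidence with the line through \<open>N\<close> in direction
  \<open>(y, z)\<close>; the normalisation turns proportional directions into equal ones.\<close>

lemma normal_dir_proportional: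
  assumes "normal_dir y z" "normal_dir y' z'"
  shows "y' * z = z' * y \<longleftrightarrow> y' = y \<and> z' = z"
  using assms by (auto simp: normal_dir_def)

lemma normal_dir_exists:
  assumes "y \<noteq> 0 \<or> z \<noteq> 0"
  obtains y' z' k where "normal_dir y' z'" "k \<noteq> 0" "y = k * y'" "z = k * z'"
proof (cases "z = 0")
  case True
  then show ?thesis
    using assms that[of 1 0 y] by (simp add: normal_dir_def)
next
  case False
  then show ?thesis
    using that[of "y / z" 1 z] by (simp add: normal_dir_def)
qed

definition afpt :: "'a::field \<times> 'a \<Rightarrow> 'a \<Rightarrow> ('a ^ 3) set" where
  "afpt d x = pt (vector [x, fst d, snd d])"

lemma afpt_eq_iff:
  assumes "normal_dir y z" "normal_dir y' z'"
  shows "afpt (y, z) x = afpt (y', z') x' \<longleftrightarrow> y = y' \<and> z = z' \<and> x = x'"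
proof -
  have "vector [x, y, z] \<noteq> (0 :: 'a ^ 3)"
    using assms(1) by (auto simp: vec3_eq_iff normal_dir_def)
  then show ?thesis
    using assms unfolding afpt_def by (auto simp: pt_eq_iff vec3_eq_iff normal_dir_def)
qed

lemma afpt_in_pg_points: "normal_dir y z \<Longrightarrow> afpt (y, z) x \<in> pg_points"
  unfolding afpt_def by (rule pt_in_pg_points) (auto simp: vec3_eq_iff normal_dir_def)

lemma pg_points_afpt:
  assumes "P \<in> pg_points"
  shows "P = pt_N \<or> (\<exists>y z x. normal_dir y z \<and> P = afpt (y, z) x)"
proof -
  obtain v where v: "v \<noteq> 0" "P = pt v"
    using assms by (rule pg_points_cases)
  show ?thesis
  proof (cases "v $ 2 \<noteq> 0 \<or> v $ 3 \<noteq> 0")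
    case True
    then obtain y z k where k: "normal_dir y z" "k \<noteq> 0" "v $ 2 = k * y" "v $ 3 = k * z"
      by (rule normal_dir_exists)
    then have "v = k *s vector [v $ 1 / k, y, z]"
      by (simp add: vec3_eq_iff)
    then have "P = afpt (y, z) (v $ 1 / k)"
      unfolding v(2) afpt_def fst_conv snd_conv using k(2) by (subst pt_eq_iff[OF v(1)]) blast
    with k(1) show ?thesis by blast
  next
    case False
    then have "v = v $ 1 *s vector [1, 0, 0]" "v $ 1 \<noteq> 0"
      using v(1) by (auto simp: vec3_eq_iff)
    then have "P = pt_N"
      unfolding v(2) pt_N_def by (subst pt_eq_iff[OF v(1)]) blast
    then show ?thesis by blast
  qed
qed

definition nline :: "'a::field \<times> 'a \<Rightarrow> ('a ^ 3) set" where
  "nline d = {v. v $ 2 * snd d = v $ 3 * fst d}"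

definition xline :: "'a::field \<Rightarrow> 'a \<Rightarrow> ('a ^ 3) set" where
  "xline a b = {v. v $ 1 = a * v $ 2 + b * v $ 3}"

lemma subspace_nline: "vec.subspace (nline d)"
  by (auto simp: vec.subspace_def nline_def algebra_simps)

lemma subspace_xline: "vec.subspace (xline a b)"
  by (auto simp: vec.subspace_def xline_def algebra_simps)

lemma nline_in_pg_lines:
  fixes y z :: "'a::{field,finite}"
  assumes "normal_dir y z"
  shows "nline (y, z) \<in> pg_lines"
proof -
  have "bij_betw (\<lambda>(x, k). vector [x, k * y, k * z]) (UNIV :: ('a \<times> 'a) set) (nline (y, z))"
  proof (rule bij_betwI')
    fix p p' :: "'a \<times> 'a"
    show "((case p of (x, k) \<Rightarrow> vector [x, k * y, k * z]) =
      ((case p' of (x, k) \<Rightarrow> vector [x, k * y, k * z]) :: 'a ^ 3)) = (p = p')"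
      using assms by (cases p; cases p') (auto simp: vec3_eq_iff normal_dir_def)
  next
    fix p :: "'a \<times> 'a"
    show "(case p of (x, k) \<Rightarrow> vector [x, k * y, k * z]) \<in> nline (y, z)"
      by (cases p) (simp add: nline_def)
  next
    fix v assume "v \<in> nline (y, z)"
    \<comment> \<open>The multiplier is read off where the normalised direction has entry 1: the
      third coordinate if \<open>z = 1\<close>, the second for the direction
      \<open>(1, 0)\<close>.\<close>
    then have "v = vector [v $ 1, (if z = 1 then v $ 3 else v $ 2) * y, (if z = 1 then v $ 3 else v $ 2) * z]"
      using assms by (auto simp: nline_def normal_dir_def vec3_eq_iff)
    then show "\<exists>p\<in>UNIV. v = (case p of (x, k) \<Rightarrow> vector [x, k * y, k * z])"
      by auto
  qed
  from bij_betw_same_card[OF this] have "card (nline (y, z)) = CARD('a) ^ 2"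
    by (simp add: power2_eq_square)
  then show ?thesis
    using subspace_dim_eqI[OF subspace_nline[of "(y, z)"], of 2] subspace_nline by (simp add: pg_lines_def)
qed

lemma xline_in_pg_lines:
  fixes a b :: "'a::{field,finite}"
  shows "xline a b \<in> pg_lines"
proof -
  have "bij_betw (\<lambda>(y, z). vector [a * y + b * z, y, z]) (UNIV :: ('a \<times> 'a) set) (xline a b)"
  proof (rule bij_betwI')
    fix p p' :: "'a \<times> 'a"
    show "((case p of (y, z) \<Rightarrow> vector [a * y + b * z, y, z]) =
      ((case p' of (y, z) \<Rightarrow> vector [a * y + b * z, y, z]) :: 'a ^ 3)) = (p = p')"
      by (cases p; cases p') (auto simp: vec3_eq_iff)
  next
    fix p :: "'a \<times> 'a"
    show "(case p of (y, z) \<Rightarrow> vector [a * y + b * z, y, z]) \<in> xline a b"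
      by (cases p) (simp add: xline_def)
  next
    fix v assume "v \<in> xline a b"
    then have "v = vector [a * v $ 2 + b * v $ 3, v $ 2, v $ 3]"
      by (auto simp: xline_def vec3_eq_iff)
    then show "\<exists>p\<in>UNIV. v = (case p of (y, z) \<Rightarrow> vector [a * y + b * z, y, z])"
      by auto
  qed
  from bij_betw_same_card[OF this] have "card (xline a b) = CARD('a) ^ 2"
    by (simp add: power2_eq_square)
  then show ?thesis
    using subspace_dim_eqI[OF subspace_xline[of a b], of 2] subspace_xline by (simp add: pg_lines_def)
qed

text \<open>A line through \<open>N\<close> is determined by the direction of one further vector. On
  a line missing \<open>N\<close>, the projection to \<open>(Y, Z)\<close> is injective, hence
  bijective by counting, and the preimages of \<open>(1, 0)\<close> and \<open>(0, 1)\<close> supply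
  the coefficients \<open>a\<close> and \<open>b\<close>.\<close>

lemma pg_lines_cases:
  fixes L :: "('a::{field,finite} ^ 3) set"
  assumes "L \<in> pg_lines"
  obtains (nline) y z where "normal_dir y z" "L = nline (y, z)"
  | (xline) a b where "L = xline a b"
proof -
  have L: "vec.subspace L" "vec.dim L = 2"
    using assms by (auto simp: pg_lines_def)
  have cardL: "card L = CARD('a) ^ 2"
    using vec.card_subspace[OF L(1)] L(2) by simp
  have eqI: "L = K" if "K \<in> pg_lines" "L \<subseteq> K \<or> K \<subseteq> L" for K
    using that vec.subspace_dim_equal[of L K] vec.subspace_dim_equal[of K L] L
    by (auto simp: pg_lines_def)
  show ?thesis
  proof (cases "vector [1, 0, 0] \<in> L")
    case N: True
    have "\<not> L \<subseteq> pt (vector [1, 0, 0])"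
    proof
      assume "L \<subseteq> pt (vector [1, 0, 0])"
      then have "vec.dim L \<le> vec.dim (pt (vector [1, 0, 0] :: 'a ^ 3))"
        by (rule vec.dim_subset)
      moreover have "vector [1, 0, 0] \<noteq> (0 :: 'a ^ 3)"
        by (simp add: vec3_eq_iff)
      ultimately show False
        using L(2) pt_in_pg_points[of "vector [1, 0, 0] :: 'a ^ 3"] by (simp add: pg_points_def)
    qed
    then obtain w where w: "w \<in> L" "w \<notin> pt (vector [1, 0, 0])"
      by blast
    have "w $ 2 \<noteq> 0 \<or> w $ 3 \<noteq> 0"
    proof (rule ccontr)
      assume "\<not> (w $ 2 \<noteq> 0 \<or> w $ 3 \<noteq> 0)"
      then have "w = w $ 1 *s vector [1, 0, 0]"
        by (simp add: vec3_eq_iff)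
      with w(2) show False
        unfolding pt_iff by blast
    qed
    then obtain y z k where k: "normal_dir y z" "k \<noteq> 0" "w $ 2 = k * y" "w $ 3 = k * z"
      by (rule normal_dir_exists)
    have "nline (y, z) \<subseteq> L"
    proof
      fix v assume v: "v \<in> nline (y, z)"
      \<comment> \<open>A multiple of \<open>w\<close> accounts for the last two coordinates of
        \<open>v\<close>; a multiple of \<open>(1, 0, 0)\<close> then corrects the first.\<close>
      define r where "r = (if z = 1 then v $ 3 else v $ 2) / k"
      have "v = (v $ 1 - r * w $ 1) *s vector [1, 0, 0] + r *s w"
        using v k by (auto simp: nline_def r_def vec3_eq_iff normal_dir_def)
      also have "\<dots> \<in> L"
        using N w(1) L(1) by (intro vec.subspace_add vec.subspace_scale)
      finally show "v \<in> L" .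
    qed
    with eqI[OF nline_in_pg_lines[OF k(1)]] k(1) nline show ?thesis
      by blast
  next
    case N: False
    define \<pi> where "\<pi> v = (v $ 2, v $ 3)" for v :: "'a ^ 3"
    have "inj_on \<pi> L"
    proof (rule inj_onI, rule ccontr)
      fix v w assume vw: "v \<in> L" "w \<in> L" "\<pi> v = \<pi> w" "v \<noteq> w"
      then have ne: "v $ 1 - w $ 1 \<noteq> 0"
        by (auto simp: \<pi>_def vec3_eq_iff)
      have "inverse (v $ 1 - w $ 1) *s (v - w) = vector [1, 0, 0]"
        using vw(3) ne by (simp add: \<pi>_def vec3_eq_iff right_diff_distrib[symmetric])
      moreover have "inverse (v $ 1 - w $ 1) *s (v - w) \<in> L"
        using vw L(1) by (intro vec.subspace_scale vec.subspace_diff)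
      ultimately show False
        using N by simp
    qed
    then have "card (\<pi> ` L) = CARD('a \<times> 'a)"
      by (simp add: card_image cardL power2_eq_square)
    then have "\<pi> ` L = UNIV"
      by (simp add: card_eq_UNIV_imp_eq_UNIV)
    then have "(1, 0) \<in> \<pi> ` L" "(0, 1) \<in> \<pi> ` L"
      by auto
    then obtain v w where vw: "v \<in> L" "\<pi> v = (1, 0)" "w \<in> L" "\<pi> w = (0, 1)"
      by force
    have "xline (v $ 1) (w $ 1) \<subseteq> L"
    proof
      fix u assume "u \<in> xline (v $ 1) (w $ 1)"
      then have "u = u $ 2 *s v + u $ 3 *s w"
        using vw by (simp add: xline_def vec3_eq_iff \<pi>_def mult.commute)
      also have "\<dots> \<in> L"
        using vw L(1) by (intro vec.subspace_add vec.subspace_scale)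
      finally show "u \<in> L" .
    qed
    with eqI[OF xline_in_pg_lines] xline show ?thesis
      by blast
  qed
qed

lemma afpt_on_nline:
  assumes "normal_dir y z" "normal_dir y' z'"
  shows "afpt (y', z') x \<in> points_on (nline (y, z)) \<longleftrightarrow> y' = y \<and> z' = z"
  using normal_dir_proportional[OF assms] afpt_in_pg_points[OF assms(2), of x] subspace_nline[of "(y, z)"]
  by (simp add: points_on_def afpt_def pt_subset_iff) (simp add: nline_def)

lemma afpt_on_xline:
  assumes "normal_dir y z"
  shows "afpt (y, z) x \<in> points_on (xline a b) \<longleftrightarrow> x = a * y + b * z"
  using afpt_in_pg_points[OF assms, of x] subspace_xline[of a b]
  by (simp add: points_on_def afpt_def pt_subset_iff) (simp add: xline_def)

lemma pt_N_in_pg_points: "pt_N \<in> pg_points"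
  unfolding pt_N_def by (rule pt_in_pg_points) (simp add: vec3_eq_iff)

lemma pt_N_subset_nline: "pt_N \<subseteq> nline d"
  unfolding pt_N_def using pt_subset_iff[OF subspace_nline[of d]] by (simp add: nline_def)

section \<open>Coordinates with respect to the powers of the primitive element\<close>

locale club_field =
  fixes lam :: "'a::{field,finite}" and h :: nat and c :: "nat \<Rightarrow> bit"
  assumes card_field: "CARD('a) = 2 ^ h"
    and primitive: "primitive_element lam"
    and minpoly: "f2_minpoly lam (monom 1 h + (\<Sum>i<h-2. monom (c i) i))"
begin

lemma char2: "(2::'a) = 0"
  by (rule two_eq_0_if_card_power_2) (rule card_field)

lemma add_self: "x + x = (0::'a)"
  using char2 by (metis mult_2 mult_zero_left)

lemma minus_eq: "- x = (x::'a)"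
  by (rule uminus_eq_self) (rule char2)

lemma lam_nz: "lam \<noteq> 0"
proof
  assume "lam = 0"
  have "lam ^ 1 \<in> UNIV - {0}"
    using primitive unfolding primitive_element_def by blast
  with \<open>lam = 0\<close> show False by simp
qed

lemma coeff_minpoly:
  "coeff (monom 1 h + (\<Sum>i<h-2. monom (c i) i)) i = (if i = h then 1 else if i < h - 2 then c i else 0)"
  by (simp add: coeff_sum del: add_bit_eq_xor) (auto)

lemma degree_minpoly: "degree (monom 1 h + (\<Sum>i<h-2. monom (c i) i)) = h"
proof (rule antisym)
  show "degree (monom 1 h + (\<Sum>i<h-2. monom (c i) i)) \<le> h"
    by (rule degree_le) (unfold coeff_minpoly, auto)
  show "h \<le> degree (monom 1 h + (\<Sum>i<h-2. monom (c i) i))"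
    by (rule le_degree) (unfold coeff_minpoly, simp)
qed

lemma lam_power_h: "lam ^ h = (\<Sum>i<h-2. of_bit (c i) * lam ^ i)"
proof -
  let ?p = "monom 1 h + (\<Sum>i<h-2. monom (c i) i)"
  have "0 = poly (map_poly of_bit ?p) lam"
    using minpoly by (simp add: f2_minpoly_def del: add_bit_eq_xor)
  also have "\<dots> = (\<Sum>i\<le>h. of_bit (coeff ?p i) * lam ^ i)"
    by (rule poly_of_bit) (simp only: degree_minpoly)
  also have "\<dots> = lam ^ h + (\<Sum>i<h. of_bit (coeff ?p i) * lam ^ i)"
    unfolding lessThan_Suc_atMost[symmetric] sum.lessThan_Suc coeff_minpoly[of h] by simp
  also have "(\<Sum>i<h. of_bit (coeff ?p i) * lam ^ i) = (\<Sum>i<h-2. of_bit (c i) * lam ^ i)"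
    unfolding coeff_minpoly by (rule sum.mono_neutral_cong_right) auto
  finally show ?thesis
    using minus_eq by (metis add_eq_0_iff)
qed

text \<open>A nontrivial relation among the powers below \<open>h\<close> would be a nonzero
  polynomial of degree less than \<open>h\<close> vanishing at \<open>lam\<close>, against the
  minimality of the degree.\<close>

lemma from_coords_eq_0:
  assumes "from_coords h lam m = 0" "i < h"
  shows "m i = 0"
proof (rule ccontr)
  assume "m i \<noteq> 0"
  define r where "r = (\<Sum>i<h. monom (m i) i)"
  have coeff: "coeff r j = (if j < h then m j else 0)" for j
    by (simp add: r_def coeff_sum)
  have deg: "degree r \<le> h - 1"
    by (rule degree_le) (auto simp: coeff)
  have "{..h-1} = {..<h}"
    using assms(2) by auto
  then have "poly (map_poly of_bit r) lam = from_coords h lam m"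
    using poly_of_bit[OF deg, of lam] by (simp add: coeff from_coords_def)
  moreover have "r \<noteq> 0"
    using coeff[of i] assms(2) \<open>m i \<noteq> 0\<close> by auto
  ultimately have "h \<le> degree r"
    using minpoly assms(1) unfolding f2_minpoly_def degree_minpoly by auto
  with deg assms(2) show False by simp
qed

text \<open>For \<open>h = 1\<close> and \<open>h = 2\<close> the relation for
  \<open>lam ^ h\<close> has an empty right side; for \<open>h = 3\<close> it forces
  \<open>lam ^ 3 = 1\<close>, too small an order for a generator of the 7 nonzero elements. From
  \<open>h \<ge> 4\<close> on, the differences \<open>h - 1\<close> to \<open>h - 3\<close> are not
  truncated, and together with 0 they are distinct indices.\<close>

lemma h_ge_4: "h \<ge> 4"
proof (rule ccontr)
  assume "\<not> h \<ge> 4"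
  have "CARD('a) \<ge> 2"
    by (metis card_2_iff card_mono finite_class.finite_UNIV subset_UNIV zero_neq_one)
  then have "h \<noteq> 0"
    using card_field by (cases h) auto
  have "h > 2"
  proof (rule ccontr)
    assume "\<not> h > 2"
    then have "lam ^ h = 0"
      using lam_power_h by simp
    with lam_nz show False by simp
  qed
  with \<open>\<not> h \<ge> 4\<close> have h: "h = 3" by simp
  then have "lam ^ 3 = of_bit (c 0)"
    using lam_power_h by (simp add: lessThan_Suc)
  with lam_nz have l3: "lam ^ 3 = 1"
    by (cases "c 0") auto
  have "{lam ^ k | k. True} \<subseteq> {1, lam, lam ^ 2}"
  proof (rule subsetI)
    fix x assume "x \<in> {lam ^ k | k. True}"
    then obtain k where x: "x = lam ^ k" by blast
    have "lam ^ k = lam ^ (3 * (k div 3) + k mod 3)"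
      by simp
    also have "\<dots> = lam ^ (k mod 3)"
      by (simp only: power_add power_mult l3 power_one mult_1_left)
    finally have "lam ^ k = lam ^ (k mod 3)" .
    moreover have "k mod 3 = 0 \<or> k mod 3 = 1 \<or> k mod 3 = 2" by auto
    ultimately show "x \<in> {1, lam, lam ^ 2}"
      using x by auto
  qed
  then have "UNIV - {0} \<subseteq> {1, lam, lam ^ 2}"
    using primitive by (simp add: primitive_element_def)
  then have "card (UNIV - {0::'a}) \<le> card {1, lam, lam ^ 2}"
    by (intro card_mono) auto
  also have "\<dots> \<le> 3"
    by (simp add: card_insert_if)
  finally show False
    using card_field h by (simp add: card_Diff_subset)
qed

lemma from_coords_add:
  "from_coords h lam (\<lambda>i. m i + n i) = from_coords h lam m + from_coords h lam n"
  unfolding from_coords_def of_bit_add[OF char2] by (simp add: sum.distrib algebra_simps)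

lemma from_coords_inj:
  assumes "from_coords h lam m = from_coords h lam n" "i < h"
  shows "m i = n i"
proof -
  have "from_coords h lam (\<lambda>i. m i + n i) = 0"
    unfolding from_coords_add by (simp add: assms(1) add_self)
  from from_coords_eq_0[OF this assms(2)] show ?thesis
    by (cases "m i"; cases "n i") simp_all
qed

text \<open>Only the entries below \<open>h\<close> enter \<open>from_coords\<close>. Extensional
  functions represent each such vector once, so the \<open>2 ^ h\<close> of them map injectively,
  hence by counting onto the field.\<close>

lemma from_coords_surj: "\<exists>m. from_coords h lam m = a"
proof -
  let ?M = "{..<h} \<rightarrow>\<^sub>E (UNIV :: bit set)"
  have "inj_on (from_coords h lam) ?M"
  proof (rule inj_onI)
    fix m n assume "m \<in> ?M" "n \<in> ?M" "from_coords h lam m = from_coords h lam n"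
    then show "m = n"
      using from_coords_inj[of m n] by (intro PiE_ext) auto
  qed
  then have "card (from_coords h lam ` ?M) = CARD('a)"
    by (simp add: card_image card_PiE card_bit card_field)
  then have "from_coords h lam ` ?M = UNIV"
    by (simp add: card_eq_UNIV_imp_eq_UNIV)
  then have "a \<in> from_coords h lam ` ?M" by simp
  then show ?thesis by (elim imageE) (rule exI, rule sym)
qed

text \<open>Only the entries with \<open>i < h\<close> are determined by \<open>a\<close>; beyond
  them the choice is arbitrary, hence the recurring condition \<open>i < h\<close>.\<close>

definition coord :: "nat \<Rightarrow> 'a \<Rightarrow> bit" where
  "coord i a = (SOME m. from_coords h lam m = a) i"

lemma from_coords_coord: "from_coords h lam (\<lambda>i. coord i a) = a"
  unfolding coord_def using someI_ex[OF from_coords_surj] by simp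

lemma coord_from_coords: "i < h \<Longrightarrow> coord i (from_coords h lam m) = m i"
  by (rule from_coords_inj) (simp_all add: from_coords_coord)

lemma coord_add: "i < h \<Longrightarrow> coord i (a + b) = coord i a + coord i b"
  using coord_from_coords[of i "\<lambda>i. coord i a + coord i b"]
  unfolding from_coords_add from_coords_coord by simp

lemma coord_zero: "i < h \<Longrightarrow> coord i 0 = 0"
  using coord_from_coords[of i "\<lambda>_. 0"] by (simp add: from_coords_def)

lemma coord_lam_power: "i < h \<Longrightarrow> j < h \<Longrightarrow> coord i (lam ^ j) = of_bool (i = j)"
proof -
  assume "i < h" "j < h"
  have "from_coords h lam (\<lambda>i. of_bool (i = j)) = (\<Sum>i<h. if i = j then lam ^ j else 0)"
    unfolding from_coords_def by (rule sum.cong) auto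
  also have "\<dots> = lam ^ j"
    using \<open>j < h\<close> by simp
  finally show ?thesis
    using coord_from_coords[OF \<open>i < h\<close>, of "\<lambda>i. of_bool (i = j)"] by simp
qed

lemma coord_sum: "i < h \<Longrightarrow> coord i (\<Sum>k\<in>K. f k) = (\<Sum>k\<in>K. coord i (f k))"
  by (induction K rule: infinite_finite_induct) (simp_all add: coord_zero coord_add del: add_bit_eq_xor)

lemma coord_of_bit_mult: "i < h \<Longrightarrow> coord i (of_bit b * a) = b * coord i a"
  by (cases b) (simp_all add: coord_zero)

lemma lam_neq_1: "lam \<noteq> 1"
  using coord_lam_power[of 0 0] coord_lam_power[of 0 1] h_ge_4 by fastforce

text \<open>The minimal polynomial does not vanish at 0: otherwise it could be divided by the variable.\<close>

lemma c_0: "c 0 = 1"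
proof (rule ccontr)
  assume "c 0 \<noteq> 1"
  have h: "h - 2 = Suc (h - 3)" and h1: "h - 1 < h"
    using h_ge_4 by simp_all
  have "lam ^ h = of_bit (c 0) * lam ^ 0 + (\<Sum>i<h-3. of_bit (c (Suc i)) * lam ^ Suc i)"
    unfolding lam_power_h h by (rule sum.lessThan_Suc_shift)
  also have "\<dots> = lam * (\<Sum>i<h-3. of_bit (c (Suc i)) * lam ^ i)"
    using \<open>c 0 \<noteq> 1\<close> by (simp add: sum_distrib_left mult.left_commute del: sum_mult_of_bool_eq sum_of_bool_mult_eq)
  also have "lam ^ h = lam * lam ^ (h - 1)"
    using h_ge_4 by (cases h) auto
  finally have "lam ^ (h - 1) = (\<Sum>i<h-3. of_bit (c (Suc i)) * lam ^ i)"
    using lam_nz by simp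
  \<comment> \<open>The left side has coordinate \<open>h - 1\<close> equal to 1, but the right side
    involves only powers below \<open>h - 3\<close>.\<close>
  then have "coord (h - 1) (lam ^ (h - 1)) = (\<Sum>i<h-3. coord (h - 1) (of_bit (c (Suc i)) * lam ^ i))"
    by (simp only: coord_sum[OF h1])
  also have "\<dots> = 0"
    using h_ge_4 by (intro sum.neutral) (auto simp: coord_zero coord_lam_power)
  finally show False
    using h_ge_4 by (simp add: coord_lam_power)
qed

text \<open>The minimal polynomial does not vanish at 1 either: otherwise divide by \<open>lam - 1\<close>.\<close>

lemma sum_c: "(\<Sum>i<h-2. c i) = 0"
proof (rule ccontr)
  assume "(\<Sum>i<h-2. c i) \<noteq> 0"
  have h1: "h - 1 < h"
    using h_ge_4 by simp
  have of_bit_sum: "of_bit (\<Sum>i<n. c i) = (\<Sum>i<n. of_bit (c i) :: 'a)" for n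
    by (induction n) (simp_all only: sum.lessThan_Suc of_bit_add[OF char2], simp)
  \<comment> \<open>By assumption the coefficients sum to 1, so their sum can stand for the
    subtracted 1; each difference \<open>lam ^ i - 1\<close> then contains the factor
    \<open>lam - 1\<close>.\<close>
  have "lam ^ h - 1 = (\<Sum>i<h-2. of_bit (c i) * lam ^ i) - (\<Sum>i<h-2. of_bit (c i))"
    using \<open>(\<Sum>i<h-2. c i) \<noteq> 0\<close> of_bit_sum[of "h - 2"] lam_power_h by simp
  also have "\<dots> = (\<Sum>i<h-2. of_bit (c i) * (lam ^ i - 1))"
    by (simp only: sum_subtractf[symmetric] right_diff_distrib mult_1_right)
  also have "\<dots> = (lam - 1) * (\<Sum>i<h-2. of_bit (c i) * (\<Sum>j<i. lam ^ j))"
    by (simp only: power_diff_1_eq sum_distrib_left) (simp only: ac_simps)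
  finally have "(\<Sum>j<h. lam ^ j) = (\<Sum>i<h-2. of_bit (c i) * (\<Sum>j<i. lam ^ j))"
    using lam_neq_1 by (simp only: power_diff_1_eq) simp
  \<comment> \<open>After cancelling \<open>lam - 1\<close>, the power \<open>lam ^ (h - 1)\<close>
    occurs on the left only.\<close>
  then have "coord (h - 1) (\<Sum>j<h. lam ^ j) = coord (h - 1) (\<Sum>i<h-2. of_bit (c i) * (\<Sum>j<i. lam ^ j))"
    by simp
  then have "(\<Sum>j<h. coord (h - 1) (lam ^ j)) =
      (\<Sum>i<h-2. c i * (\<Sum>j<i. coord (h - 1) (lam ^ j)))"
    by (simp only: coord_sum[OF h1] coord_of_bit_mult[OF h1])
  also have "(\<Sum>j<h. coord (h - 1) (lam ^ j)) = (\<Sum>j<h. if j = h - 1 then 1 else 0)"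
    by (rule sum.cong) (use h_ge_4 in \<open>auto simp: coord_lam_power\<close>)
  also have "\<dots> = 1"
    using h_ge_4 by simp
  also have "(\<Sum>i<h-2. c i * (\<Sum>j<i. coord (h - 1) (lam ^ j))) = 0"
  proof (rule sum.neutral, rule ballI)
    fix i assume "i \<in> {..<h-2}"
    then have "(\<Sum>j<i. coord (h - 1) (lam ^ j)) = 0"
      by (intro sum.neutral) (auto simp: coord_lam_power)
    then show "c i * (\<Sum>j<i. coord (h - 1) (lam ^ j)) = 0" by simp
  qed
  finally show False by simp
qed

section \<open>Coordinate functionals and multiplication by \<open>lam\<close>\<close>

definition E0 :: "'a \<Rightarrow> bool" where "E0 a \<longleftrightarrow> coord 0 a = 1"
text \<open>The index k stands for coordinate \<open>h - k\<close>, with coordinate 0 in the role of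
  \<open>h\<close>. In this numbering multiplication of the argument by \<open>lam\<close> turns
  index k into k + 1 for k = 0, 1, 2.\<close>

definition E1 :: "'a \<Rightarrow> bool" where "E1 a \<longleftrightarrow> coord (h - 1) a = 1"
definition E2 :: "'a \<Rightarrow> bool" where "E2 a \<longleftrightarrow> coord (h - 2) a = 1"
definition E3 :: "'a \<Rightarrow> bool" where "E3 a \<longleftrightarrow> coord (h - 3) a = 1"
definition S :: "'a \<Rightarrow> bool" where "S a \<longleftrightarrow> (\<Sum>i=0..h-3. coord i a) = 1"

lemma E_add:
  "E0 (a + b) \<longleftrightarrow> E0 a \<noteq> E0 b" "E1 (a + b) \<longleftrightarrow> E1 a \<noteq> E1 b" "E2 (a + b) \<longleftrightarrow> E2 a \<noteq> E2 b"
  "E3 (a + b) \<longleftrightarrow> E3 a \<noteq> E3 b"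
  using h_ge_4
  by (simp_all add: E0_def E1_def E2_def E3_def coord_add bit_add_eq_1_iff del: add_bit_eq_xor)

lemma S_add: "S (a + b) \<longleftrightarrow> S a \<noteq> S b"
proof -
  have "(\<Sum>i=0..h-3. coord i (a + b)) = (\<Sum>i=0..h-3. coord i a) + (\<Sum>i=0..h-3. coord i b)"
    unfolding sum.distrib[symmetric] using h_ge_4 by (intro sum.cong refl coord_add) auto
  then show ?thesis
    by (simp only: S_def bit_add_eq_1_iff)
qed

text \<open>All coordinates move up by one place, and the term of degree \<open>h\<close> arising
  from the top coordinate is reduced by \<open>lam_power_h\<close>.\<close>

lemma coord_lam_mult:
  assumes "i < h"
  shows "coord i (lam * a) =
    (if i = 0 then 0 else coord (i - 1) a) + coord (h - 1) a * (if i < h - 2 then c i else 0)"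
proof -
  obtain n where n: "h = Suc n"
    using h_ge_4 by (cases h) auto
  have "lam * a = lam * from_coords h lam (\<lambda>j. coord j a)"
    by (simp only: from_coords_coord)
  also have "\<dots> = (\<Sum>j<h. of_bit (coord j a) * lam ^ Suc j)"
    unfolding from_coords_def sum_distrib_left by (intro sum.cong refl) (simp only: power_Suc ac_simps)
  also have "\<dots> = (\<Sum>j<n. of_bit (coord j a) * lam ^ Suc j) + of_bit (coord n a) * lam ^ h"
    unfolding n by (rule sum.lessThan_Suc)
  finally have "coord i (lam * a) =
      (\<Sum>j<n. coord j a * coord i (lam ^ Suc j)) + coord n a * coord i (lam ^ h)"
    by (simp only: coord_add[OF assms] coord_sum[OF assms] coord_of_bit_mult[OF assms])
  also have "coord i (lam ^ h) = (\<Sum>j<h-2. c j * coord i (lam ^ j))"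
    by (simp only: lam_power_h coord_sum[OF assms] coord_of_bit_mult[OF assms])
  also have "\<dots> = (\<Sum>j<h-2. if j = i then c i else 0)"
    by (rule sum.cong) (use assms in \<open>auto simp: coord_lam_power\<close>)
  also have "\<dots> = (if i < h - 2 then c i else 0)"
    by simp
  also have "(\<Sum>j<n. coord j a * coord i (lam ^ Suc j)) = (\<Sum>j<n. if Suc j = i then coord (i - 1) a else 0)"
  proof (rule sum.cong)
    fix j assume "j \<in> {..<n}"
    then have "Suc j < h"
      using n by simp
    then show "coord j a * coord i (lam ^ Suc j) = (if Suc j = i then coord (i - 1) a else 0)"
      using coord_lam_power[OF assms] by (auto simp del: power_Suc)
  qed simp
  also have "\<dots> = (if i = 0 then 0 else coord (i - 1) a)"
    using assms n by (cases i) auto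
  finally show ?thesis
    by (simp only: n diff_Suc_1)
qed

lemma E_lam: "E0 (lam * a) \<longleftrightarrow> E1 a" "E1 (lam * a) \<longleftrightarrow> E2 a" "E2 (lam * a) \<longleftrightarrow> E3 a"
proof -
  have *: "0 < h" "h - 1 < h" "h - 2 < h" "\<not> h - 1 < h - 2" "h - 1 - 1 = h - 2" "h - 2 - 1 = h - 3"
    "h - 1 \<noteq> 0" "h - 2 \<noteq> 0" "0 < h - 2"
    using h_ge_4 by auto
  show "E0 (lam * a) \<longleftrightarrow> E1 a" "E1 (lam * a) \<longleftrightarrow> E2 a" "E2 (lam * a) \<longleftrightarrow> E3 a"
    unfolding E0_def E1_def E2_def E3_def coord_lam_mult[OF *(1)] coord_lam_mult[OF *(2)]
      coord_lam_mult[OF *(3)]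
    using * c_0 by (simp_all del: diff_diff_left)
qed

text \<open>The shift pushes coordinate \<open>h - 3\<close> out of the range of summation, while
  the reduction of the top term adds \<open>coord (h - 1) a\<close> times the sum of the
  \<open>c i\<close>, which is 0.\<close>

lemma S_lam: "S (lam * a) \<longleftrightarrow> S a \<noteq> E3 a"
proof -
  obtain n where n: "h = n + 4"
    using h_ge_4 by (metis add.commute le_Suc_ex)
  have "(\<Sum>i=0..h-3. coord i (lam * a)) =
      (\<Sum>i<Suc (Suc n). (if i = 0 then 0 else coord (i - 1) a) + coord (h - 1) a * c i)"
  proof (rule sum.cong)
    fix i assume "i \<in> {..<Suc (Suc n)}"
    then have "i < h" "i < h - 2"
      using n by simp_all
    then show "coord i (lam * a) = (if i = 0 then 0 else coord (i - 1) a) + coord (h - 1) a * c i"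
      by (simp only: coord_lam_mult if_True)
  qed (auto simp: n)
  also have "\<dots> = (\<Sum>i<Suc (Suc n). if i = 0 then 0 else coord (i - 1) a) +
      coord (h - 1) a * (\<Sum>i<Suc (Suc n). c i)"
    by (simp only: sum.distrib sum_distrib_left)
  also have "(\<Sum>i<Suc (Suc n). c i) = 0"
    using sum_c by (simp only: n) simp
  also have "(\<Sum>i<Suc (Suc n). if i = 0 then 0 else coord (i - 1) a) = (\<Sum>i<Suc n. coord i a)"
    by (subst sum.lessThan_Suc_shift) (simp del: sum.lessThan_Suc)
  finally have l: "(\<Sum>i=0..h-3. coord i (lam * a)) = (\<Sum>i<Suc n. coord i a)"
    by simp
  have "(\<Sum>i=0..h-3. coord i a) = (\<Sum>i<Suc (Suc n). coord i a)"
    by (rule sum.cong) (auto simp: n)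
  also have "\<dots> = (\<Sum>i<Suc n. coord i a) + coord (h - 3) a"
    by (simp only: sum.lessThan_Suc) (simp add: n)
  finally have r: "(\<Sum>i=0..h-3. coord i a) = (\<Sum>i<Suc n. coord i a) + coord (h - 3) a" .
  show ?thesis
    by (simp only: S_def E3_def l r bit_add_eq_1_iff) blast
qed

lemma E_power:
  assumes "j < h"
  shows "E0 (lam ^ j) \<longleftrightarrow> j = 0" "E1 (lam ^ j) \<longleftrightarrow> j = h - 1" "E2 (lam ^ j) \<longleftrightarrow> j = h - 2"
    "E3 (lam ^ j) \<longleftrightarrow> j = h - 3" "S (lam ^ j) \<longleftrightarrow> j \<le> h - 3"
proof -
  have "(\<Sum>i=0..h-3. coord i (lam ^ j)) = (\<Sum>i=0..h-3. if i = j then 1 else 0)"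
    by (rule sum.cong) (use assms h_ge_4 in \<open>auto simp: coord_lam_power\<close>)
  then show "S (lam ^ j) \<longleftrightarrow> j \<le> h - 3"
    by (simp add: S_def)
qed (use assms h_ge_4 in \<open>auto simp: E0_def E1_def E2_def E3_def coord_lam_power\<close>)

lemma E_0: "\<not> E0 0" "\<not> E1 0" "\<not> E2 0" "\<not> E3 0" "\<not> S 0"
  using E_add(1)[of 0 0] E_add(2)[of 0 0] E_add(3)[of 0 0] E_add(4)[of 0 0] S_add[of 0 0] by auto

section \<open>Membership in the arc in terms of the functionals\<close>

lemma coords_Collect:
  assumes "\<And>m. Q m \<longleftrightarrow> R (from_coords h lam m)"
  shows "{f (from_coords h lam m) | m. Q m} = {f a | a. R a}"
  using assms from_coords_surj by (auto, metis)

lemma from_coords_E: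
  "E1 (from_coords h lam m) \<longleftrightarrow> m (h - 1) = 1"
  "E2 (from_coords h lam m) \<longleftrightarrow> m (h - 2) = 1"
  "E3 (from_coords h lam m) \<longleftrightarrow> m (h - 3) = 1"
  "S (from_coords h lam m) \<longleftrightarrow> (\<Sum>i=0..h-3. m i) = 1"
  "E0 (from_coords h lam m) \<longleftrightarrow> m 0 = 1"
proof -
  have "(\<Sum>i=0..h-3. coord i (from_coords h lam m)) = (\<Sum>i=0..h-3. m i)"
    by (rule sum.cong) (use h_ge_4 in \<open>auto simp: coord_from_coords\<close>)
  then show "S (from_coords h lam m) \<longleftrightarrow> (\<Sum>i=0..h-3. m i) = 1"
    by (simp only: S_def)
qed (use h_ge_4 in \<open>auto simp: E0_def E1_def E2_def E3_def coord_from_coords\<close>)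

text \<open>The condition on the X-coordinate in each direction. In the last one the sum up to
  \<open>h - 2\<close> is \<open>S\<close> plus coordinate \<open>h - 2\<close>, so its vanishing
  reads \<open>S a = E2 a\<close>.\<close>

fun in_arc :: "'a \<times> 'a \<Rightarrow> 'a \<Rightarrow> bool" where
  "in_arc (y, z) a \<longleftrightarrow>
    (z = 0 \<and> y = 1 \<and> \<not> E2 a \<and> E3 a) \<or>
    (z = 1 \<and> (y = 0 \<and> \<not> E1 a \<and> E2 a \<or>
      y = 1 \<and> \<not> E2 a \<and> \<not> S a \<or>
      y = lam \<and> E1 a \<noteq> E2 a \<and> \<not> S a \<or>
      y = lam\<^sup>2 \<and> \<not> E1 a \<and> S a = E2 a))"

text \<open>The directions of the five lines through \<open>N\<close> that turn out to be the
  q/4-secants.\<close>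

definition dirs :: "('a \<times> 'a) set" where
  "dirs = {(1, 0), (0, 1), (1, 1), (lam, 1), (lam\<^sup>2, 1)}"

lemma lam_distinct: "lam \<noteq> 0" "lam \<noteq> 1" "lam\<^sup>2 \<noteq> 0" "lam\<^sup>2 \<noteq> 1" "lam\<^sup>2 \<noteq> lam" "1 + lam \<noteq> 0"
proof -
  show "1 + lam \<noteq> 0"
  proof
    assume "1 + lam = 0"
    then have "1 + lam = 1 + 1"
      by (simp only: add_self)
    then show False
      using lam_neq_1 by (simp only: add_left_cancel)
  qed
  show "lam\<^sup>2 \<noteq> 1"
    using lam_neq_1 unfolding power2_eq_1_iff minus_eq by simp
  show "lam\<^sup>2 \<noteq> lam"
    using lam_neq_1 lam_nz by (auto simp: power2_eq_square)
qed (use lam_nz lam_neq_1 in auto)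

lemma arc_A0_eq: "arc_A0 h lam = {afpt d a | d a. in_arc d a}"
proof -
  have A: "S_A h lam = {afpt (1, 0) a | a. \<not> E2 a \<and> E3 a}"
    unfolding S_A_def afpt_def fst_conv snd_conv
    by (rule coords_Collect) (simp add: from_coords_E)
  have B: "S_B h lam = {afpt (0, 1) a | a. \<not> E1 a \<and> E2 a}"
    unfolding S_B_def afpt_def fst_conv snd_conv
    by (rule coords_Collect) (simp add: from_coords_E)
  have C: "S_C0 h lam = {afpt (1, 1) a | a. \<not> E2 a \<and> \<not> S a}"
    unfolding S_C0_def afpt_def fst_conv snd_conv
    by (rule coords_Collect) (simp add: from_coords_E)
  have D: "S_D0 h lam = {afpt (lam, 1) a | a. E1 a \<noteq> E2 a \<and> \<not> S a}"
    unfolding S_D0_def afpt_def fst_conv snd_conv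
    by (rule coords_Collect) (simp add: from_coords_E bit_add_eq_1_iff del: add_bit_eq_xor)
  have h2: "h - 2 = Suc (h - 3)"
    using h_ge_4 by simp
  have E: "S_E0 h lam = {afpt (lam\<^sup>2, 1) a | a. \<not> E1 a \<and> S a = E2 a}"
    unfolding S_E0_def afpt_def fst_conv snd_conv
  proof (rule coords_Collect)
    fix m :: "nat \<Rightarrow> bit"
    have "(\<Sum>i=0..h-2. m i) = (\<Sum>i=0..h-3. m i) + m (h - 2)"
      unfolding h2 by simp
    then have "(\<Sum>i=0..h-2. m i) = 0 \<longleftrightarrow> ((\<Sum>i=0..h-3. m i) = 1) = (m (h - 2) = 1)"
      by (cases "\<Sum>i=0..h-3. m i"; cases "m (h - 2)") (simp_all only: add_0_left add_0_right, simp_all)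
    then show "m (h - 1) = 0 \<and> (\<Sum>i=0..h-2. m i) = 0 \<longleftrightarrow>
      \<not> E1 (from_coords h lam m) \<and> S (from_coords h lam m) = E2 (from_coords h lam m)"
      by (simp only: from_coords_E) simp
  qed
  show ?thesis
    unfolding arc_A0_def A B C D E by auto
qed

section \<open>The KM-arc and its nucleus\<close>

lemma in_arc_simps:
  "in_arc (1, 0) a \<longleftrightarrow> \<not> E2 a \<and> E3 a"
  "in_arc (0, 1) a \<longleftrightarrow> \<not> E1 a \<and> E2 a"
  "in_arc (1, 1) a \<longleftrightarrow> \<not> E2 a \<and> \<not> S a"
  "in_arc (lam, 1) a \<longleftrightarrow> E1 a \<noteq> E2 a \<and> \<not> S a"
  "in_arc (lam\<^sup>2, 1) a \<longleftrightarrow> \<not> E1 a \<and> S a = E2 a"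
  using lam_distinct lam_distinct[symmetric] by auto

declare in_arc.simps [simp del]

lemma in_arc_dirs: "in_arc d a \<Longrightarrow> d \<in> dirs"
  by (cases d) (auto simp: in_arc.simps dirs_def)

lemma normal_dirs: "(y, z) \<in> dirs \<Longrightarrow> normal_dir y z"
  by (auto simp: dirs_def normal_dir_def)

lemma normal_in_arc: "in_arc (y, z) a \<Longrightarrow> normal_dir y z"
  using in_arc_dirs normal_dirs by blast

lemma afpt_in_arc:
  assumes "normal_dir y z"
  shows "afpt (y, z) a \<in> arc_A0 h lam \<longleftrightarrow> in_arc (y, z) a"
proof
  assume "afpt (y, z) a \<in> arc_A0 h lam"
  then obtain y' z' a' where "in_arc (y', z') a'" "afpt (y, z) a = afpt (y', z') a'"
    unfolding arc_A0_eq by auto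
  with afpt_eq_iff[OF assms normal_in_arc] show "in_arc (y, z) a"
    by auto
qed (auto simp: arc_A0_eq)

lemma arc_A0_subset: "arc_A0 h lam \<subseteq> pg_points"
  unfolding arc_A0_eq by (auto intro!: afpt_in_pg_points dest: normal_in_arc)

lemma h_bounds: "0 < h" "h - 1 < h" "h - 2 < h" "h - 3 < h"
  "h - 1 \<noteq> h - 2" "h - 2 \<noteq> h - 1" "h - 2 \<noteq> h - 3" "h - 3 \<noteq> h - 2" "h - 1 \<noteq> h - 3" "h - 3 \<noteq> h - 1"
  "\<not> h - 1 \<le> h - 3" "\<not> h - 2 \<le> h - 3" "h - 1 \<noteq> 0" "h - 2 \<noteq> 0" "0 \<noteq> h - 1" "0 \<noteq> h - 2" "h - 3 \<noteq> 0"
  using h_ge_4 by linarith+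

lemmas E_one = E_power[OF h_bounds(1), unfolded power_0]

text \<open>These rules evaluate the functionals on sums, multiples by \<open>lam\<close> and the
  relevant powers, which turns membership in the arc into propositional logic.\<close>

lemmas functional_simps = E_power[OF h_bounds(2)] E_power[OF h_bounds(3)] E_power[OF h_bounds(4)] E_one
  E_add S_add E_lam S_lam E_0

lemma xor_additive_E:
  "xor_additive E0" "xor_additive E1" "xor_additive E2" "xor_additive E3" "xor_additive S"
  "xor_additive (\<lambda>a. E1 a \<noteq> E2 a)" "xor_additive (\<lambda>a. S a \<noteq> E2 a)"
  unfolding xor_additive_def E_add S_add by blast+

text \<open>In each direction two functionals are prescribed, where the sums \<open>E1 + E2\<close>
  and \<open>S + E2\<close> count as functionals too. The witnesses \<open>u\<close> and
  \<open>v\<close> show that the two are independent.\<close>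

lemma card_in_arc:
  assumes "d \<in> dirs"
  shows "card {a. in_arc d a} = CARD('a) div 4"
proof -
  have 1: "card {a. E2 a = False \<and> E3 a = True} = CARD('a) div 4"
    by (rule card_quarter[OF xor_additive_E(3,4), where u = "lam ^ (h - 2)" and v = "lam ^ (h - 3)"])
      (simp_all only: xor_additive_E functional_simps h_bounds simp_thms)
  have 2: "card {a. E1 a = False \<and> E2 a = True} = CARD('a) div 4"
    by (rule card_quarter[OF xor_additive_E(2,3), where u = "lam ^ (h - 1)" and v = "lam ^ (h - 2)"])
      (simp_all only: xor_additive_E functional_simps h_bounds simp_thms)
  have 3: "card {a. E2 a = False \<and> S a = False} = CARD('a) div 4"
    by (rule card_quarter[OF xor_additive_E(3,5), where u = "lam ^ (h - 2)" and v = 1])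
      (simp_all only: xor_additive_E functional_simps h_bounds simp_thms)
  have 4: "card {a. (E1 a \<noteq> E2 a) = True \<and> S a = False} = CARD('a) div 4"
    by (rule card_quarter[OF xor_additive_E(6,5), where u = "lam ^ (h - 2)" and v = 1])
      (simp_all only: xor_additive_E functional_simps h_bounds simp_thms)
  have 5: "card {a. E1 a = False \<and> (S a \<noteq> E2 a) = False} = CARD('a) div 4"
    by (rule card_quarter[OF xor_additive_E(2,7), where u = "lam ^ (h - 1)" and v = 1])
      (simp_all only: xor_additive_E functional_simps h_bounds simp_thms)
  show ?thesis
    using assms 1 2 3 4 5 by (auto simp: dirs_def in_arc_simps)
qed

lemma card_arc_nline:
  assumes "normal_dir y z"
  shows "card (arc_A0 h lam \<inter> points_on (nline (y, z))) =
    (if (y, z) \<in> dirs then CARD('a) div 4 else 0)"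
proof -
  have "arc_A0 h lam \<inter> points_on (nline (y, z)) = afpt (y, z) ` {a. in_arc (y, z) a}"
  proof (intro set_eqI iffI)
    fix P assume P: "P \<in> arc_A0 h lam \<inter> points_on (nline (y, z))"
    then obtain y' z' a where a: "in_arc (y', z') a" "P = afpt (y', z') a"
      unfolding arc_A0_eq by auto
    then have "y' = y \<and> z' = z"
      using P afpt_on_nline[OF assms normal_in_arc] by blast
    with a show "P \<in> afpt (y, z) ` {a. in_arc (y, z) a}"
      by auto
  next
    fix P assume "P \<in> afpt (y, z) ` {a. in_arc (y, z) a}"
    then show "P \<in> arc_A0 h lam \<inter> points_on (nline (y, z))"
      using afpt_on_nline[OF assms assms] afpt_in_arc[OF assms] by auto
  qed
  moreover have "inj_on (afpt (y, z)) {a. in_arc (y, z) a}"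
    using afpt_eq_iff[OF assms assms] by (auto intro: inj_onI)
  ultimately have "card (arc_A0 h lam \<inter> points_on (nline (y, z))) = card {a. in_arc (y, z) a}"
    by (simp add: card_image)
  moreover have "{a. in_arc (y, z) a} = {}" if "(y, z) \<notin> dirs"
    using that in_arc_dirs by blast
  ultimately show ?thesis
    using card_in_arc by auto
qed

lemma sum_dirs:
  "(\<Sum>d\<in>dirs. f d) = f (1, 0) + f (0, 1) + f (1, 1) + f (lam, 1) + f (lam\<^sup>2, 1)"
  for f :: "_ \<Rightarrow> nat"
  unfolding dirs_def using lam_distinct lam_distinct[symmetric] by simp

text \<open>An \<open>xline\<close> has exactly one point in each direction, so the intersection
  number is a sum of five indicators.\<close>

lemma card_arc_xline_eq:
  "card (arc_A0 h lam \<inter> points_on (xline a b)) =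
    of_bool (in_arc (1, 0) a) + of_bool (in_arc (0, 1) b) + of_bool (in_arc (1, 1) (a + b)) +
    of_bool (in_arc (lam, 1) (lam * a + b)) + of_bool (in_arc (lam\<^sup>2, 1) (lam * (lam * a) + b))"
proof -
  define x where "x d = a * fst d + b * snd d" for d
  have "arc_A0 h lam \<inter> points_on (xline a b) = (\<lambda>d. afpt d (x d)) ` (dirs \<inter> {d. in_arc d (x d)})"
  proof (intro set_eqI iffI)
    fix P assume P: "P \<in> arc_A0 h lam \<inter> points_on (xline a b)"
    then obtain y z c where c: "in_arc (y, z) c" "P = afpt (y, z) c"
      unfolding arc_A0_eq by auto
    moreover have "c = x (y, z)"
      using P c afpt_on_xline[OF normal_in_arc[OF c(1)], of c a b] by (auto simp: x_def)
    ultimately show "P \<in> (\<lambda>d. afpt d (x d)) ` (dirs \<inter> {d. in_arc d (x d)})"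
      using in_arc_dirs by (auto intro!: image_eqI[of _ _ "(y, z)"])
  next
    fix P assume "P \<in> (\<lambda>d. afpt d (x d)) ` (dirs \<inter> {d. in_arc d (x d)})"
    then obtain y z where d: "(y, z) \<in> dirs" "in_arc (y, z) (x (y, z))" "P = afpt (y, z) (x (y, z))"
      by auto
    then show "P \<in> arc_A0 h lam \<inter> points_on (xline a b)"
      using afpt_on_xline[OF normal_dirs[OF d(1)], of "x (y, z)" a b] afpt_in_arc[OF normal_dirs[OF d(1)]]
      by (auto simp: x_def)
  qed
  moreover have "inj_on (\<lambda>d. afpt d (x d)) (dirs \<inter> {d. in_arc d (x d)})"
  proof (rule inj_onI)
    fix d d' assume "d \<in> dirs \<inter> {d. in_arc d (x d)}" "d' \<in> dirs \<inter> {d. in_arc d (x d)}"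
      "afpt d (x d) = afpt d' (x d')"
    then show "d = d'"
      using afpt_eq_iff[OF normal_dirs normal_dirs] by (cases d; cases d') auto
  qed
  ultimately have "card (arc_A0 h lam \<inter> points_on (xline a b)) = card (dirs \<inter> {d. in_arc d (x d)})"
    by (simp add: card_image)
  also have "\<dots> = (\<Sum>d\<in>dirs. of_bool (in_arc d (x d)))"
    by (simp add: dirs_def)
  finally show ?thesis
    by (simp add: sum_dirs x_def power2_eq_square mult.commute mult.left_commute)
qed

text \<open>The bit \<open>E3 (lam * a)\<close>, which does not reduce to the other functionals of
  \<open>a\<close>, enters the last indicator through both \<open>S\<close> and \<open>E2\<close>
  and cancels in their comparison. This leaves only six bits.\<close>

lemma card_arc_xline_bits:
  "card (arc_A0 h lam \<inter> points_on (xline a b)) =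
    of_bool (\<not> E2 a \<and> E3 a) + of_bool (\<not> E1 b \<and> E2 b) +
    of_bool (E2 a = E2 b \<and> S a = S b) +
    of_bool ((E2 a \<noteq> E1 b) \<noteq> (E3 a \<noteq> E2 b) \<and> (S a \<noteq> E3 a) = S b) +
    of_bool (E3 a = E1 b \<and> ((S a \<noteq> E3 a) \<noteq> S b) = E2 b)"
  unfolding card_arc_xline_eq in_arc_simps functional_simps
  by (intro arg_cong2[where f = "(+)"] arg_cong[where f = of_bool]) blast+

lemma card_arc_xline: "card (arc_A0 h lam \<inter> points_on (xline a b)) \<in> {0, 2}"
  unfolding card_arc_xline_bits
  by (cases "E1 b"; cases "E2 a"; cases "E3 a"; cases "E2 b"; cases "S a"; cases "S b"; simp)

text \<open>This separates q/4 from 0 and 2, so that an \<open>xline\<close> is never a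
  q/4-secant.\<close>

lemma quarter_ge_4: "CARD('a) div 4 \<ge> 4"
proof -
  obtain n where "h = n + 4"
    using h_ge_4 by (metis add.commute le_Suc_ex)
  then show ?thesis
    by (simp add: card_field power_add)
qed

lemma card_arc: "card (arc_A0 h lam) = CARD('a) + CARD('a) div 4"
proof -
  have "arc_A0 h lam = (\<lambda>(d, a). afpt d a) ` (SIGMA d:dirs. {a. in_arc d a})"
    unfolding arc_A0_eq using in_arc_dirs by (auto simp: image_iff)
  moreover have "inj_on (\<lambda>(d, a). afpt d a) (SIGMA d:dirs. {a. in_arc d a})"
    using afpt_eq_iff[OF normal_dirs normal_dirs] by (auto intro!: inj_onI)
  ultimately have "card (arc_A0 h lam) = card (SIGMA d:dirs. {a. in_arc d a})"
    by (simp add: card_image)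
  also have "\<dots> = (\<Sum>d\<in>dirs. card {a. in_arc d a})"
    by (rule card_SigmaI) (simp_all add: dirs_def)
  also have "\<dots> = (\<Sum>d\<in>dirs. CARD('a) div 4)"
    by (rule sum.cong) (simp_all add: card_in_arc)
  also have "\<dots> = 5 * (CARD('a) div 4)"
    by (simp only: sum_dirs)
  \<comment> \<open>The division by 4 is exact because \<open>h \<ge> 4\<close>.\<close>
  also have "\<dots> = CARD('a) + CARD('a) div 4"
  proof -
    obtain n where "h = n + 4"
      using h_ge_4 by (metis add.commute le_Suc_ex)
    then show ?thesis
      by (simp add: card_field power_add)
  qed
  finally show ?thesis .
qed

lemma km_arc_A0: "km_arc (CARD('a) div 4) (arc_A0 h lam)"
  unfolding km_arc_def
proof (intro conjI arc_A0_subset card_arc ballI)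
  fix L :: "('a ^ 3) set" assume "L \<in> pg_lines"
  then show "card (arc_A0 h lam \<inter> points_on L) \<in> {0, 2, CARD('a) div 4}"
  proof (cases rule: pg_lines_cases)
    case (nline y z)
    then show ?thesis
      using card_arc_nline by auto
  next
    case (xline a b)
    then show ?thesis
      using card_arc_xline[of a b] by auto
  qed
next
  fix n assume n: "n \<in> {0, 2, CARD('a) div 4}"
  \<comment> \<open>The bits of \<open>a\<close> and \<open>b\<close> are chosen to make all five
    indicators false, which gives an external line.\<close>
  define a where "a = lam ^ (h - 2)"
  define b where "b = lam ^ (h - 1) + lam ^ (h - 2) + 1"
  have "E2 a" "\<not> E3 a" "\<not> S a" "E1 b" "E2 b" "S b"
    unfolding a_def b_def by (simp_all only: functional_simps h_bounds simp_thms)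
  then have "card (arc_A0 h lam \<inter> points_on (xline a b)) = 0"
    by (simp add: card_arc_xline_bits)
  \<comment> \<open>The line \<open>X = 0\<close> meets the arc in \<open>(0, 1, 1)\<close> and
    \<open>(0, lam^2, 1)\<close>.\<close>
  moreover have "card (arc_A0 h lam \<inter> points_on (xline 0 0)) = 2"
    by (simp add: card_arc_xline_bits E_0)
  moreover have "card (arc_A0 h lam \<inter> points_on (nline (1, 0))) = CARD('a) div 4"
    by (subst card_arc_nline) (simp_all add: normal_dir_def dirs_def)
  ultimately show "\<exists>L\<in>pg_lines. card (arc_A0 h lam \<inter> points_on L) = n"
    using n xline_in_pg_lines nline_in_pg_lines[of 1 "0::'a"] by (auto simp: normal_dir_def)
qed

lemma nucleus_A0: "nucleus (CARD('a) div 4) (arc_A0 h lam) pt_N"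
  unfolding nucleus_def
proof (intro conjI ballI pt_N_in_pg_points)
  let ?t = "CARD('a) div 4"
  fix P :: "('a ^ 3) set" assume P: "P \<in> pg_points"
  show "(\<forall>L\<in>pg_lines. card (arc_A0 h lam \<inter> points_on L) = ?t \<longrightarrow> P \<subseteq> L) \<longleftrightarrow> P = pt_N"
  proof
    assume all: "\<forall>L\<in>pg_lines. card (arc_A0 h lam \<inter> points_on L) = ?t \<longrightarrow> P \<subseteq> L"
    have on: "P \<in> points_on (nline (y, z))" if "(y, z) \<in> dirs" for y z
      using all that P nline_in_pg_lines[OF normal_dirs] card_arc_nline[OF normal_dirs]
      by (auto simp: points_on_def)
    \<comment> \<open>The two q/4-secants \<open>Z = 0\<close> and \<open>Y = 0\<close> already meet
      in \<open>N\<close> alone.\<close>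
    have "P \<in> points_on (nline (1, 0))" "P \<in> points_on (nline (0, 1))"
      by (rule on; simp add: dirs_def)+
    moreover have n: "normal_dir 1 (0::'a)" "normal_dir 0 (1::'a)"
      by (simp_all add: normal_dir_def)
    ultimately show "P = pt_N"
      using pg_points_afpt[OF P] afpt_on_nline[OF n(1)] afpt_on_nline[OF n(2)] by (metis zero_neq_one)
  next
    assume "P = pt_N"
    show "\<forall>L\<in>pg_lines. card (arc_A0 h lam \<inter> points_on L) = ?t \<longrightarrow> P \<subseteq> L"
    proof (intro ballI impI)
      fix L :: "('a ^ 3) set" assume "L \<in> pg_lines" "card (arc_A0 h lam \<inter> points_on L) = ?t"
      then show "P \<subseteq> L"
      proof (cases rule: pg_lines_cases)
        case (nline y z)
        then show ?thesis
          using \<open>P = pt_N\<close> pt_N_subset_nline by simp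
      next
        case (xline a b)
        then show ?thesis
          using card_arc_xline[of a b] quarter_ge_4 \<open>card (arc_A0 h lam \<inter> points_on L) = ?t\<close> by auto
      qed
    qed
  qed
qed

section \<open>Elations\<close>

text \<open>The elation adding \<open>Y - lam * Z\<close> times a vector on the axis; in characteristic 2 all
  minus signs become plus signs.\<close>

definition elation_mat :: "'a \<Rightarrow> 'a \<Rightarrow> 'a ^ 3 ^ 3" where
  "elation_mat \<alpha> \<beta> = vector [vector [1, \<alpha>, lam * \<alpha>], vector [0, 1 + lam * \<beta>, lam * (lam * \<beta>)],
    vector [0, \<beta>, 1 + lam * \<beta>]]"

lemma elation_mat_mult:
  "elation_mat \<alpha> \<beta> *v v = v + (v $ 2 + lam * v $ 3) *s vector [\<alpha>, lam * \<beta>, \<beta>]"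
  by (simp add: vec3_eq_iff elation_mat_def matrix_vector_mult_def sum_3 algebra_simps)

text \<open>The added vector lies on the axis, so the value of \<open>Y + lam * Z\<close> is
  unchanged by the first map and the parameters simply add up.\<close>

lemma elation_mat_el: "elation_mat \<alpha> \<beta> *v (elation_mat \<alpha>' \<beta>' *v v) = elation_mat (\<alpha> + \<alpha>') (\<beta> + \<beta>') *v v"
proof -
  define r where "r = v $ 2 + lam * v $ 3"
  have "(elation_mat \<alpha>' \<beta>' *v v) $ 2 + lam * (elation_mat \<alpha>' \<beta>' *v v) $ 3 = r + (r * (lam * \<beta>') + r * (lam * \<beta>'))"
    by (simp add: elation_mat_mult r_def algebra_simps)
  then have "(elation_mat \<alpha>' \<beta>' *v v) $ 2 + lam * (elation_mat \<alpha>' \<beta>' *v v) $ 3 = r"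
    by (simp only: add_self add_0_right)
  then have "elation_mat \<alpha> \<beta> *v (elation_mat \<alpha>' \<beta>' *v v) = v + r *s vector [\<alpha>', lam * \<beta>', \<beta>'] + r *s vector [\<alpha>, lam * \<beta>, \<beta>]"
    by (simp only: elation_mat_mult[of \<alpha> \<beta> "elation_mat \<alpha>' \<beta>' *v v"]) (simp only: elation_mat_mult r_def)
  also have "\<dots> = elation_mat (\<alpha> + \<alpha>') (\<beta> + \<beta>') *v v"
    unfolding elation_mat_mult r_def[symmetric] by (simp add: vec3_eq_iff algebra_simps)
  finally show ?thesis .
qed

lemma elation_mat_involution: "elation_mat \<alpha> \<beta> *v (elation_mat \<alpha> \<beta> *v v) = v"
  unfolding elation_mat_el add_self by (simp add: elation_mat_mult vec3_eq_iff)

lemma pgl_map_el_el: "pgl_map (elation_mat \<alpha> \<beta>) (pgl_map (elation_mat \<alpha>' \<beta>') P) = pgl_map (elation_mat (\<alpha> + \<alpha>') (\<beta> + \<beta>')) P"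
  by (simp add: pgl_map_def image_image elation_mat_el)

lemma pgl_map_el_involution: "pgl_map (elation_mat \<alpha> \<beta>) (pgl_map (elation_mat \<alpha> \<beta>) P) = P"
  by (simp add: pgl_map_def image_image elation_mat_involution)

lemma line_l_eq: "line_l lam = nline (lam, 1)"
  by (auto simp: line_l_def nline_def mult.commute)

lemma elation_el: "elation (line_l lam) (elation_mat \<alpha> \<beta>)"
proof -
  define w :: "'a ^ 3" where "w = vector [\<alpha>, lam * \<beta>, \<beta>]"
  have "elation_mat \<alpha> \<beta> ** elation_mat \<alpha> \<beta> = mat 1"
    unfolding matrix_eq by (simp add: matrix_vector_mul_assoc[symmetric] elation_mat_involution)
  then have "invertible (elation_mat \<alpha> \<beta>)"
    unfolding invertible_def by blast
  moreover have "pgl_map (elation_mat \<alpha> \<beta>) P = P" if "P \<in> points_on (line_l lam)" for P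
  proof -
    have "elation_mat \<alpha> \<beta> *v v = v" if "v \<in> line_l lam" for v
      using that by (simp add: elation_mat_mult line_l_def add_self)
    with that show ?thesis
      by (force simp: points_on_def pgl_map_def image_iff)
  qed
  \<comment> \<open>Vectors move by multiples of \<open>w\<close>, so the centre is the point
    spanned by \<open>w\<close>. If \<open>w = 0\<close>, the map is the identity and
    \<open>N\<close> serves as centre.\<close>
  moreover have "\<exists>C\<in>points_on (line_l lam). w \<in> C"
  proof (cases "w = 0")
    case True
    then show ?thesis
      using pt_N_in_pg_points pt_N_subset_nline vec.subspace_0[OF subspace_pt]
      unfolding line_l_eq points_on_def pt_N_def by blast
  next
    case False
    moreover have "w \<in> nline (lam, 1)"
      by (simp add: w_def nline_def)
    ultimately show ?thesis
      using pt_in_pg_points[of w] self_in_pt[of w] pt_subset_iff[OF subspace_nline, of w "(lam, 1)"]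
      unfolding line_l_eq points_on_def by blast
  qed
  moreover have "pgl_map (elation_mat \<alpha> \<beta>) L = L" if L: "L \<in> pg_lines" "w \<in> L" for L
  proof -
    have "elation_mat \<alpha> \<beta> *v v \<in> L" if "v \<in> L" for v
      unfolding elation_mat_mult w_def[symmetric] using L that
      by (auto simp: pg_lines_def intro: vec.subspace_add vec.subspace_scale)
    then show ?thesis
      unfolding pgl_map_def using elation_mat_involution by (auto simp: image_iff) metis
  qed
  ultimately show ?thesis
    unfolding elation_def by blast
qed

section \<open>Elations stabilising the arc\<close>

definition stabilizes :: "'a \<Rightarrow> 'a \<Rightarrow> bool" where
  "stabilizes \<alpha> \<beta> \<longleftrightarrow> (\<forall>P \<in> arc_A0 h lam. pgl_map (elation_mat \<alpha> \<beta>) P \<in> arc_A0 h lam)"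

text \<open>The maps are involutions, so mapping the arc into itself already means mapping it onto
  itself.\<close>

lemma stabilizes_image: "stabilizes \<alpha> \<beta> \<Longrightarrow> pgl_map (elation_mat \<alpha> \<beta>) ` arc_A0 h lam = arc_A0 h lam"
  unfolding stabilizes_def using pgl_map_el_involution by (auto simp: image_iff) metis

lemma stabilizes_add: "stabilizes \<alpha> \<beta> \<Longrightarrow> stabilizes \<alpha>' \<beta>' \<Longrightarrow> stabilizes (\<alpha> + \<alpha>') (\<beta> + \<beta>')"
  unfolding stabilizes_def pgl_map_el_el[symmetric] by blast

text \<open>The factor \<open>k\<close> brings the image vector back to a normalised
  direction.\<close>

lemma elation_mat_afpt:
  assumes "k \<noteq> 0" "x + (y + lam * z) * \<alpha> = k * x'" "y + (y + lam * z) * (lam * \<beta>) = k * y'"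
    "z + (y + lam * z) * \<beta> = k * z'"
  shows "pgl_map (elation_mat \<alpha> \<beta>) (afpt (y, z) x) = afpt (y', z') x'"
proof -
  have "elation_mat \<alpha> \<beta> *v vector [x, y, z] = k *s vector [x', y', z']"
    using assms by (simp only: elation_mat_mult vec3_eq_iff vector_3 vector_add_component
      vector_smult_component simp_thms)
  then show ?thesis
    using assms(1) by (simp add: afpt_def pgl_map_pt pt_scale)
qed

lemma afpt_in_arcI: "in_arc d x \<Longrightarrow> afpt d x \<in> arc_A0 h lam"
  unfolding arc_A0_eq by blast

text \<open>Points in direction \<open>(lam, 1)\<close> lie on the axis and are fixed, so four
  directions remain.\<close>

lemma stabilizesI:
  assumes "\<And>x. in_arc (1, 0) x \<Longrightarrow> pgl_map (elation_mat \<alpha> \<beta>) (afpt (1, 0) x) \<in> arc_A0 h lam"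
    "\<And>x. in_arc (0, 1) x \<Longrightarrow> pgl_map (elation_mat \<alpha> \<beta>) (afpt (0, 1) x) \<in> arc_A0 h lam"
    "\<And>x. in_arc (1, 1) x \<Longrightarrow> pgl_map (elation_mat \<alpha> \<beta>) (afpt (1, 1) x) \<in> arc_A0 h lam"
    "\<And>x. in_arc (lam\<^sup>2, 1) x \<Longrightarrow> pgl_map (elation_mat \<alpha> \<beta>) (afpt (lam\<^sup>2, 1) x) \<in> arc_A0 h lam"
  shows "stabilizes \<alpha> \<beta>"
proof -
  have "pgl_map (elation_mat \<alpha> \<beta>) (afpt (lam, 1) x) = afpt (lam, 1) x" for x
    by (rule elation_mat_afpt[where k = 1]) (simp_all add: add_self)
  then have D: "pgl_map (elation_mat \<alpha> \<beta>) (afpt (lam, 1) x) \<in> arc_A0 h lam" if "in_arc (lam, 1) x" for x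
    using afpt_in_arcI[OF that] by simp
  have "pgl_map (elation_mat \<alpha> \<beta>) (afpt d x) \<in> arc_A0 h lam" if "in_arc d x" for d x
    using in_arc_dirs[OF that] that assms D unfolding dirs_def by blast
  then show ?thesis
    unfolding stabilizes_def arc_A0_eq by blast
qed

lemma stabilizes_translation:
  assumes "\<not> E2 \<alpha>" "\<not> E3 \<alpha>"
  shows "stabilizes \<alpha> 0"
proof (rule stabilizesI)
  fix x
  have elation_mat: "pgl_map (elation_mat \<alpha> 0) (afpt (y, z) x) = afpt (y, z) (x + (y + lam * z) * \<alpha>)" for y z
    by (rule elation_mat_afpt[where k = 1]) simp_all
  show "in_arc (1, 0) x \<Longrightarrow> pgl_map (elation_mat \<alpha> 0) (afpt (1, 0) x) \<in> arc_A0 h lam"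
    unfolding elation_mat using assms by (intro afpt_in_arcI) (simp add: in_arc_simps functional_simps)
  show "in_arc (0, 1) x \<Longrightarrow> pgl_map (elation_mat \<alpha> 0) (afpt (0, 1) x) \<in> arc_A0 h lam"
    unfolding elation_mat using assms by (intro afpt_in_arcI) (simp add: in_arc_simps functional_simps)
  show "in_arc (1, 1) x \<Longrightarrow> pgl_map (elation_mat \<alpha> 0) (afpt (1, 1) x) \<in> arc_A0 h lam"
    unfolding elation_mat using assms
    by (intro afpt_in_arcI) (simp add: in_arc_simps functional_simps distrib_right)
  \<comment> \<open>Adding this element changes \<open>S\<close> and \<open>E2\<close> by the same
    bit \<open>E3 (lam * \<alpha>)\<close>, so the condition \<open>S = E2\<close> survives.\<close>
  have "(lam\<^sup>2 + lam * 1) * \<alpha> = lam * (lam * \<alpha>) + lam * \<alpha>"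
    by (simp add: power2_eq_square distrib_right)
  then show "in_arc (lam\<^sup>2, 1) x \<Longrightarrow> pgl_map (elation_mat \<alpha> 0) (afpt (lam\<^sup>2, 1) x) \<in> arc_A0 h lam"
    unfolding elation_mat using assms
    by (intro afpt_in_arcI) (simp add: in_arc_simps functional_simps, blast)
qed

lemma E_div_lam: "E2 (x / lam) \<longleftrightarrow> E1 x" "E3 (x / lam) \<longleftrightarrow> E2 x" "S (x / lam) \<longleftrightarrow> S x \<noteq> E2 x"
  using E_lam[of "x / lam"] S_lam[of "x / lam"] lam_nz by auto

text \<open>With \<open>lam * \<beta> = 1\<close> the direction \<open>(y, z)\<close> becomes
  \<open>(lam * z, y / lam)\<close> before normalisation. This swaps \<open>(1, 0)\<close> with
  \<open>(0, 1)\<close>, and \<open>(1, 1)\<close> with \<open>(lam^2, 1)\<close>.\<close>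

lemma elation_mat_lam:
  "pgl_map (elation_mat 0 (1 / lam)) (afpt (1, 0) x) = afpt (0, 1) (lam * x)"
  "pgl_map (elation_mat 0 (1 / lam)) (afpt (0, 1) x) = afpt (1, 0) (x / lam)"
  "pgl_map (elation_mat 0 (1 / lam)) (afpt (1, 1) x) = afpt (lam\<^sup>2, 1) (lam * x)"
  "pgl_map (elation_mat 0 (1 / lam)) (afpt (lam\<^sup>2, 1) x) = afpt (1, 1) (x / lam)"
proof -
  have e: "lam * (1 / lam) = 1" "u + (u + w) = w" "u + (w + u) = w" for u w :: 'a
    using lam_nz add_self[of u] by (simp_all add: add.assoc[symmetric] add_self add.commute)
  show "pgl_map (elation_mat 0 (1 / lam)) (afpt (1, 0) x) = afpt (0, 1) (lam * x)"
    by (rule elation_mat_afpt[where k = "1 / lam"]) (use lam_nz in \<open>simp_all add: e add_self\<close>)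
  show "pgl_map (elation_mat 0 (1 / lam)) (afpt (0, 1) x) = afpt (1, 0) (x / lam)"
    by (rule elation_mat_afpt[where k = lam]) (use lam_nz in \<open>simp_all add: e add_self\<close>)
  show "pgl_map (elation_mat 0 (1 / lam)) (afpt (1, 1) x) = afpt (lam\<^sup>2, 1) (lam * x)"
    by (rule elation_mat_afpt[where k = "1 / lam"])
      (use lam_nz in \<open>simp_all add: e power2_eq_square add_divide_distrib add_self\<close>)
  show "pgl_map (elation_mat 0 (1 / lam)) (afpt (lam\<^sup>2, 1) x) = afpt (1, 1) (x / lam)"
    by (rule elation_mat_afpt[where k = lam])
      (use lam_nz in \<open>simp_all add: e power2_eq_square add_divide_distrib add_self\<close>)
qed

lemma stabilizes_lam: "stabilizes 0 (1 / lam)"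
  by (rule stabilizesI; unfold elation_mat_lam; rule afpt_in_arcI)
    (auto simp: in_arc_simps functional_simps E_div_lam)

text \<open>This second involution pairs the directions differently: \<open>(1, 0)\<close> with
  \<open>(1, 1)\<close>, and \<open>(0, 1)\<close> with \<open>(lam^2, 1)\<close>.\<close>

lemma elation_mat_one_lam:
  fixes \<alpha> :: 'a
  defines "T \<equiv> pgl_map (elation_mat \<alpha> (1 / (1 + lam)))"
  shows "T (afpt (1, 0) x) = afpt (1, 1) ((1 + lam) * (x + \<alpha>))"
    "T (afpt (0, 1) x) = afpt (lam\<^sup>2, 1) ((1 + lam) * (x + lam * \<alpha>))"
    "T (afpt (1, 1) x) = afpt (1, 0) (x / (1 + lam) + \<alpha>)"
    "T (afpt (lam\<^sup>2, 1) x) = afpt (0, 1) (x / (1 + lam) + lam * \<alpha>)"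
proof -
  \<comment> \<open>Writing \<open>lam = r + 1\<close> makes \<open>r\<close> the only denominator,
    and the remaining terms cancel in pairs in characteristic 2.\<close>
  define r where "r = 1 + lam"
  have r: "r \<noteq> 0" "lam = r + 1"
    using lam_distinct add_self[of 1] by (simp_all add: r_def add.assoc[symmetric] add.commute)
  have e: "u + (u + w) = w" "u + (w + u) = w" for u w :: 'a
    using add_self[of u] by (simp_all add: add.assoc[symmetric] add.commute)
  show "T (afpt (1, 0) x) = afpt (1, 1) ((1 + lam) * (x + \<alpha>))"
    unfolding T_def r_def[symmetric]
    by (rule elation_mat_afpt[where k = "1 / r"]) (use r(1) in \<open>simp_all add: r(2) field_simps e add_self\<close>)
  show "T (afpt (0, 1) x) = afpt (lam\<^sup>2, 1) ((1 + lam) * (x + lam * \<alpha>))"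
    unfolding T_def r_def[symmetric]
    by (rule elation_mat_afpt[where k = "1 / r"]) (use r(1) in \<open>simp_all add: r(2) power2_eq_square field_simps e add_self\<close>)
  show "T (afpt (1, 1) x) = afpt (1, 0) (x / (1 + lam) + \<alpha>)"
    unfolding T_def r_def[symmetric]
    by (rule elation_mat_afpt[where k = r]) (use r(1) in \<open>simp_all add: r(2) field_simps e add_self\<close>)
  show "T (afpt (lam\<^sup>2, 1) x) = afpt (0, 1) (x / (1 + lam) + lam * \<alpha>)"
    unfolding T_def r_def[symmetric]
    by (rule elation_mat_afpt[where k = r]) (use r(1) in \<open>simp_all add: r(2) power2_eq_square field_simps e add_self\<close>)
qed

text \<open>Here \<open>x = u + lam * u\<close>. In \<open>S x\<close> the two copies of
  \<open>S u\<close> cancel, and only the correction \<open>E3 u\<close> from \<open>S_lam\<close>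
  remains.\<close>

lemma E_div_one_lam:
  fixes x :: 'a
  defines "u \<equiv> x / (1 + lam)"
  shows "E1 x \<longleftrightarrow> E1 u \<noteq> E2 u" "E2 x \<longleftrightarrow> E2 u \<noteq> E3 u" "S x \<longleftrightarrow> E3 u"
proof -
  have "x = (1 + lam) * u"
    using lam_distinct(6) by (simp add: u_def)
  then have x: "x = u + lam * u"
    by (simp add: distrib_right)
  show "E1 x \<longleftrightarrow> E1 u \<noteq> E2 u" "E2 x \<longleftrightarrow> E2 u \<noteq> E3 u" "S x \<longleftrightarrow> E3 u"
    unfolding x functional_simps by blast+
qed

lemma stabilizes_one_lam: "stabilizes (lam ^ (h - 3)) (1 / (1 + lam))"
proof (rule stabilizesI; unfold elation_mat_one_lam; rule afpt_in_arcI)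
  \<comment> \<open>The shift by \<open>lam ^ (h - 3)\<close> flips \<open>E3\<close>: direction
    \<open>(1, 0)\<close> requires \<open>E3\<close>, whereas in direction \<open>(1, 1)\<close> the
    functional \<open>S\<close>, which equals \<open>E3\<close> before multiplication by
    \<open>1 + lam\<close>, has to vanish.\<close>
  have \<alpha>: "E3 (lam ^ (h - 3))" "\<not> E2 (lam ^ (h - 3))" "\<not> E1 (lam ^ (h - 3))"
    by (simp_all only: functional_simps h_bounds simp_thms)
  have d: "(1 + lam) * w = w + lam * w" for w
    by (simp add: distrib_right)
  fix x
  show "in_arc (1, 0) x \<Longrightarrow> in_arc (1, 1) ((1 + lam) * (x + lam ^ (h - 3)))"
    unfolding in_arc_simps d using \<alpha> by (simp only: functional_simps) blast
  show "in_arc (0, 1) x \<Longrightarrow> in_arc (lam\<^sup>2, 1) ((1 + lam) * (x + lam * lam ^ (h - 3)))"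
    unfolding in_arc_simps d using \<alpha> by (simp only: functional_simps) blast
  show "in_arc (1, 1) x \<Longrightarrow> in_arc (1, 0) (x / (1 + lam) + lam ^ (h - 3))"
    unfolding in_arc_simps E_div_one_lam[of x] using \<alpha> by (simp only: E_add) blast
  show "in_arc (lam\<^sup>2, 1) x \<Longrightarrow> in_arc (0, 1) (x / (1 + lam) + lam * lam ^ (h - 3))"
    unfolding in_arc_simps E_div_one_lam[of x] using \<alpha> by (simp only: E_add E_lam) blast
qed

section \<open>Transitivity off the axis\<close>

definition base :: "('a ^ 3) set" where
  "base = afpt (1, 0) (lam ^ (h - 3))"

text \<open>The stabilising elations are closed under composition and are involutions, so
  transitivity reduces to reaching each point from the single arc point \<open>base\<close>.\<close>

definition reachable :: "('a ^ 3) set \<Rightarrow> bool" where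
  "reachable P \<longleftrightarrow> (\<exists>\<alpha> \<beta>. stabilizes \<alpha> \<beta> \<and> pgl_map (elation_mat \<alpha> \<beta>) base = P)"

lemma reachable_back:
  assumes "stabilizes \<alpha> \<beta>" "reachable (pgl_map (elation_mat \<alpha> \<beta>) P)"
  shows "reachable P"
proof -
  obtain \<alpha>' \<beta>' where s: "stabilizes \<alpha>' \<beta>'" "pgl_map (elation_mat \<alpha>' \<beta>') base = pgl_map (elation_mat \<alpha> \<beta>) P"
    using assms(2) unfolding reachable_def by blast
  then have "pgl_map (elation_mat (\<alpha> + \<alpha>') (\<beta> + \<beta>')) base = P"
    by (simp add: pgl_map_el_el[symmetric] pgl_map_el_involution)
  with stabilizes_add[OF assms(1) s(1)] show ?thesis
    unfolding reachable_def by blast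
qed

text \<open>In direction \<open>(1, 0)\<close> the shift is exactly \<open>\<alpha>\<close>. The
  difference of two admissible X-coordinates has vanishing \<open>E2\<close> and \<open>E3\<close>,
  hence gives a stabilising elation.\<close>

lemma reachable_10:
  assumes "in_arc (1, 0) x"
  shows "reachable (afpt (1, 0) x)"
proof -
  let ?\<alpha> = "x + lam ^ (h - 3)"
  have "\<not> E2 ?\<alpha>" "\<not> E3 ?\<alpha>"
    using assms in_arc_simps(1)[of x] by (simp_all only: functional_simps h_bounds simp_thms)
  moreover have "pgl_map (elation_mat ?\<alpha> 0) base = afpt (1, 0) x"
    unfolding base_def
    by (rule elation_mat_afpt[where k = 1]) (simp_all add: add.left_commute[of _ x] add_self)
  ultimately show ?thesis
    using stabilizes_translation unfolding reachable_def by blast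
qed

text \<open>The two pairings lead back to direction \<open>(1, 0)\<close>: directly from
  \<open>(0, 1)\<close> and \<open>(1, 1)\<close>, and by way of \<open>(0, 1)\<close> from
  \<open>(lam^2, 1)\<close>.\<close>

lemma reachable_arc:
  assumes "P \<in> arc_A0 h lam" "P \<notin> points_on (line_l lam)"
  shows "reachable P"
proof -
  have in_arcD: "in_arc d x" if "pgl_map (elation_mat \<alpha> \<beta>) (afpt d' x') = afpt d x" "in_arc d' x'" "stabilizes \<alpha> \<beta>"
    "normal_dir (fst d) (snd d)" for d d' x x' \<alpha> \<beta>
    using that afpt_in_arcI[OF that(2)] afpt_in_arc[of "fst d" "snd d" x] unfolding stabilizes_def by force
  have 01: "reachable (afpt (0, 1) x)" if "in_arc (0, 1) x" for x
    by (rule reachable_back[OF stabilizes_lam], unfold elation_mat_lam, rule reachable_10,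
      rule in_arcD[OF elation_mat_lam(2) that stabilizes_lam]) (simp add: normal_dir_def)
  have 11: "reachable (afpt (1, 1) x)" if "in_arc (1, 1) x" for x
    by (rule reachable_back[OF stabilizes_one_lam], unfold elation_mat_one_lam, rule reachable_10,
      rule in_arcD[OF elation_mat_one_lam(3) that stabilizes_one_lam]) (simp add: normal_dir_def)
  have 21: "reachable (afpt (lam\<^sup>2, 1) x)" if "in_arc (lam\<^sup>2, 1) x" for x
    by (rule reachable_back[OF stabilizes_one_lam], unfold elation_mat_one_lam, rule 01,
      rule in_arcD[OF elation_mat_one_lam(4) that stabilizes_one_lam]) (simp add: normal_dir_def)
  obtain d x where d: "in_arc d x" "P = afpt d x"
    using assms(1) unfolding arc_A0_eq by blast
  have "afpt (lam, 1) x \<in> points_on (line_l lam)"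
    unfolding line_l_eq by (subst afpt_on_nline) (simp_all add: normal_dir_def)
  then have "d \<noteq> (lam, 1)"
    using d(2) assms(2) by blast
  then show ?thesis
    using in_arc_dirs[OF d(1)] d reachable_10 01 11 21 unfolding dirs_def by blast
qed

lemma translation_line_A0: "translation_line (arc_A0 h lam) (line_l lam)"
  unfolding translation_line_def
proof (intro conjI ballI)
  show "line_l lam \<in> pg_lines"
    unfolding line_l_eq by (rule nline_in_pg_lines) (simp add: normal_dir_def)
  fix P Q assume "P \<in> arc_A0 h lam - points_on (line_l lam)" "Q \<in> arc_A0 h lam - points_on (line_l lam)"
  then obtain \<alpha> \<beta> \<alpha>' \<beta>' where s: "stabilizes \<alpha> \<beta>" "pgl_map (elation_mat \<alpha> \<beta>) base = P"
    "stabilizes \<alpha>' \<beta>'" "pgl_map (elation_mat \<alpha>' \<beta>') base = Q"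
    using reachable_arc unfolding reachable_def by blast
  have "pgl_map (elation_mat (\<alpha>' + \<alpha>) (\<beta>' + \<beta>)) P = Q"
    unfolding pgl_map_el_el[symmetric] s(2)[symmetric] pgl_map_el_involution by (rule s(4))
  then show "\<exists>M. elation (line_l lam) M \<and> pgl_map M ` arc_A0 h lam = arc_A0 h lam \<and> pgl_map M P = Q"
    using elation_el stabilizes_image[OF stabilizes_add[OF s(3,1)]] by blast
qed

section \<open>The club\<close>

definition snd_coord :: "bool \<Rightarrow> bool \<Rightarrow> 'a" where
  "snd_coord p r = of_bool p + of_bool r * lam"

lemma snd_coord_add: "snd_coord p r + snd_coord p' r' = snd_coord (p \<noteq> p') (r \<noteq> r')"
  unfolding snd_coord_def using add_self[of lam] char2
  by (cases p; cases p'; cases r; cases r') (simp_all add: algebra_simps)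

lemma snd_coord_eq_0: "snd_coord p r = 0 \<longleftrightarrow> \<not> p \<and> \<not> r"
  unfolding snd_coord_def using lam_distinct by (cases p; cases r) simp_all

lemma snd_coord_eq_iff: "snd_coord p r = snd_coord p' r' \<longleftrightarrow> p = p' \<and> r = r'"
proof
  assume "snd_coord p r = snd_coord p' r'"
  then have "snd_coord (p \<noteq> p') (r \<noteq> r') = 0"
    unfolding snd_coord_add[symmetric] by (simp only: add_self)
  then show "p = p' \<and> r = r'"
    by (simp add: snd_coord_eq_0)
qed simp

lemma E_snd_coord:
  "E0 (x * snd_coord p r) \<longleftrightarrow> (p \<and> E0 x) \<noteq> (r \<and> E1 x)"
  "E1 (x * snd_coord p r) \<longleftrightarrow> (p \<and> E1 x) \<noteq> (r \<and> E2 x)"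
proof -
  have "x * snd_coord p r = (if p then x else 0) + (if r then lam * x else 0)"
    by (simp add: snd_coord_def distrib_left mult.commute)
  then show "E0 (x * snd_coord p r) \<longleftrightarrow> (p \<and> E0 x) \<noteq> (r \<and> E1 x)"
    "E1 (x * snd_coord p r) \<longleftrightarrow> (p \<and> E1 x) \<noteq> (r \<and> E2 x)"
    by (simp_all add: functional_simps)
qed

text \<open>The coordinates of \<open>x\<close> are the parameters \<open>t 1\<close> to
  \<open>t (h - 1)\<close> and \<open>r\<close> is \<open>t h\<close>. Since \<open>E1 x\<close> is
  \<open>t (h - 1)\<close>, it is the constant term of the second entry; the condition
  \<open>\<not> E0 x\<close> in \<open>W\<close> records that no \<open>t 0\<close> occurs.\<close>

definition club_vec :: "'a \<Rightarrow> bool \<Rightarrow> 'a ^ 2" where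
  "club_vec x r = vector [x, snd_coord (E1 x) r]"

definition W :: "('a ^ 2) set" where
  "W = {club_vec x r | x r. \<not> E0 x}"

lemma club_vec_eq_iff: "club_vec x r = club_vec x' r' \<longleftrightarrow> x = x' \<and> r = r'"
  by (auto simp: club_vec_def vec2_eq_iff snd_coord_eq_iff)

lemma club_vec_0: "club_vec 0 False = 0"
  by (simp add: club_vec_def vec2_eq_iff E_0 snd_coord_eq_0)

lemma club_vec_add: "club_vec x r + club_vec x' r' = club_vec (x + x') (r \<noteq> r')"
  by (simp add: club_vec_def vec2_eq_iff snd_coord_add E_add)

lemma W_0: "0 \<in> W"
  unfolding W_def using club_vec_0 E_0 by (auto intro: sym)

lemma W_add: "v \<in> W \<Longrightarrow> w \<in> W \<Longrightarrow> v + w \<in> W"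
  unfolding W_def by (auto simp: club_vec_add) (metis E_add(1))

lemma club_C_eq: "club_C h lam = linear_set W"
proof (intro set_eqI iffI)
  fix P assume "P \<in> club_C h lam"
  then obtain t i where t: "i \<in> {1..h}" "t i \<noteq> (0::bit)"
    and P: "P = pt (vector [\<Sum>i=1..h-1. of_bit (t i) * lam ^ i, of_bit (t (h - 1)) + of_bit (t h) * lam])"
    unfolding club_C_def by auto
  \<comment> \<open>The value \<open>t 0\<close> is arbitrary in \<open>club_C\<close>, so it is
    overwritten to obtain coordinate 0.\<close>
  let ?x = "from_coords h lam (t(0 := 0))"
  have "?x = (\<Sum>i=1..h-1. of_bit (t i) * lam ^ i)"
    unfolding from_coords_def by (rule sum.mono_neutral_cong_right) auto
  moreover have "E1 ?x \<longleftrightarrow> t (h - 1) = 1" "\<not> E0 ?x"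
    unfolding from_coords_E using h_bounds by simp_all
  ultimately have P': "P = pt (club_vec ?x (t h = 1))"
    unfolding P club_vec_def snd_coord_def by simp
  have "club_vec ?x (t h = 1) \<noteq> 0"
  proof
    assume "club_vec ?x (t h = 1) = 0"
    then have x: "?x = 0" "t h \<noteq> 1"
      unfolding club_vec_0[symmetric] club_vec_eq_iff by simp_all
    have "t i = 0"
    proof (cases "i = h")
      case False
      then show ?thesis
        using from_coords_eq_0[OF x(1), of i] t(1) by simp
    qed (use x in simp)
    with t(2) show False by simp
  qed
  with P' \<open>\<not> E0 ?x\<close> show "P \<in> linear_set W"
    unfolding linear_set_def W_def by blast
next
  fix P assume "P \<in> linear_set W"
  then obtain x r where x: "P = pt (club_vec x r)" "\<not> E0 x" "club_vec x r \<noteq> 0"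
    unfolding linear_set_def W_def by blast
  define t where "t i = (if i = h then of_bool r else coord i x)" for i
  have "x = from_coords h lam (\<lambda>i. coord i x)"
    by (simp only: from_coords_coord)
  also have "\<dots> = (\<Sum>i=1..h-1. of_bit (t i) * lam ^ i)"
    unfolding from_coords_def
    by (rule sum.mono_neutral_cong_right) (use x(2) in \<open>auto simp: t_def E0_def not_le\<close>)
  finally have sum: "x = (\<Sum>i=1..h-1. of_bit (t i) * lam ^ i)" .
  have "P = pt (vector [\<Sum>i=1..h-1. of_bit (t i) * lam ^ i, of_bit (t (h - 1)) + of_bit (t h) * lam])"
    using less_imp_neq[OF h_bounds(2)] unfolding x(1) club_vec_def snd_coord_def sum[symmetric]
    by (simp add: t_def E1_def del: One_nat_def)
  moreover have "\<exists>i\<in>{1..h}. t i \<noteq> 0"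
  proof (rule ccontr)
    assume no: "\<not> (\<exists>i\<in>{1..h}. t i \<noteq> 0)"
    then have "x = 0"
      by (subst sum) (auto intro!: sum.neutral)
    moreover have "t h = 0"
      using no h_bounds(1) by auto
    then have "\<not> r"
      by (simp add: t_def)
    ultimately show False
      using x(3) club_vec_0 by simp
  qed
  ultimately show "P \<in> club_C h lam"
    unfolding club_C_def by blast
qed

section \<open>Weights and affine points of the club\<close>

abbreviation head :: "('a ^ 2) set" where
  "head \<equiv> pt (vector [1, 0])"

lemma pt_on_axis: "x \<noteq> 0 \<Longrightarrow> pt (vector [x, 0] :: 'a ^ 2) = head"
  by (subst pt_eq_iff) (auto simp: vec2_eq_iff)

lemma weight_eqI:
  assumes "card (W \<inter> pt w) = 2 ^ n"
  shows "weight W (pt w) = n"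
  unfolding weight_def
proof (rule f2_dim_eqI[OF char2 _ assms], rule f2_subspaceI[OF char2])
  show "0 \<in> W \<inter> pt w"
    using W_0 vec.subspace_0[OF subspace_pt] by blast
  show "u + v \<in> W \<inter> pt w" if "u \<in> W \<inter> pt w" "v \<in> W \<inter> pt w" for u v
    using that W_add vec.subspace_add[OF subspace_pt] by blast
qed

lemma head_in_club: "head \<in> club_C h lam"
proof -
  have "club_vec lam False \<in> W" "club_vec lam False = vector [lam, 0]"
    using E_lam(1,2)[of 1] E_one(2,3) h_bounds unfolding W_def club_vec_def snd_coord_def by auto
  moreover have "(vector [lam, 0] :: 'a ^ 2) \<noteq> 0"
    using lam_nz by (simp add: vec2_eq_iff)
  ultimately show ?thesis
    unfolding club_C_eq linear_set_def using pt_on_axis[OF lam_nz, symmetric]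
    by (intro CollectI exI[of _ "vector [lam, 0]"]) simp
qed

text \<open>The head collects the vectors with \<open>E0\<close>, \<open>E1\<close> and
  \<open>r\<close> all false, q/4 in number. Any other point contains a single nonzero vector of
  \<open>W\<close>, since two proportional ones have the same second entry.\<close>

lemma f2_club_C: "f2_club (h - 2) h (club_C h lam)"
  unfolding f2_club_def
proof (intro exI[of _ W] conjI club_C_eq bexI[of _ head] ballI)
  show sub: "f2_subspace W"
    by (rule f2_subspaceI[OF char2 W_0 W_add])
  have "bij_betw (\<lambda>(x, r). club_vec x r) ({x. \<not> E0 x} \<times> UNIV) W"
    by (rule bij_betw_imageI) (auto simp: inj_on_def club_vec_eq_iff W_def image_iff)
  from bij_betw_same_card[OF this] have "card W = 2 * card {x. \<not> E0 x}"
    by (simp add: card_cartesian_product card_UNIV_bool)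
  also have "\<dots> = 2 ^ h"
    using card_half[OF xor_additive_E(1), of 1] by (simp add: functional_simps card_field)
  finally show "f2_dim W = h"
    by (rule f2_dim_eqI[OF char2 sub])
next
  show "head \<in> club_C h lam"
    by (rule head_in_club)
next
  have "W \<inter> head = (\<lambda>x. club_vec x False) ` {x. E0 x = False \<and> E1 x = False}"
  proof (intro set_eqI iffI)
    fix v assume v: "v \<in> W \<inter> head"
    then obtain x r k where x: "v = club_vec x r" "\<not> E0 x" "v = k *s vector [1, 0]"
      unfolding W_def Int_iff pt_iff by blast
    then have "snd_coord (E1 x) r = 0"
      by (simp add: club_vec_def vec2_eq_iff)
    with x show "v \<in> (\<lambda>x. club_vec x False) ` {x. E0 x = False \<and> E1 x = False}"
      by (auto simp: snd_coord_eq_0)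
  next
    fix v assume "v \<in> (\<lambda>x. club_vec x False) ` {x. E0 x = False \<and> E1 x = False}"
    then obtain x where x: "v = club_vec x False" "\<not> E0 x" "\<not> E1 x"
      by blast
    then have "v = x *s vector [1, 0]"
      by (simp add: club_vec_def vec2_eq_iff snd_coord_eq_0)
    with x show "v \<in> W \<inter> head"
      unfolding W_def Int_iff pt_iff by blast
  qed
  moreover have "card \<dots> = card {x. E0 x = False \<and> E1 x = False}"
    by (rule card_image) (simp add: inj_on_def club_vec_eq_iff)
  moreover have "\<dots> = CARD('a) div 4"
    by (rule card_quarter[OF xor_additive_E(1,2), where u = 1 and v = "lam ^ (h - 1)"])
      (simp_all only: functional_simps h_bounds simp_thms)
  moreover have "CARD('a) div 4 = 2 ^ (h - 2)"
  proof -
    obtain n where "h = n + 4"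
      using h_ge_4 by (metis add.commute le_Suc_ex)
    then show ?thesis
      by (simp add: card_field power_add)
  qed
  ultimately show "weight W head = h - 2"
    by (intro weight_eqI) simp
next
  fix P assume "P \<in> club_C h lam - {head}"
  then obtain x r where x: "\<not> E0 x" "club_vec x r \<noteq> 0" "P = pt (club_vec x r)" "P \<noteq> head"
    unfolding club_C_eq linear_set_def W_def by blast
  have nz: "E1 x \<or> r"
  proof (rule ccontr)
    assume "\<not> (E1 x \<or> r)"
    then have "club_vec x r = vector [x, 0]"
      by (simp add: club_vec_def vec2_eq_iff snd_coord_eq_0)
    moreover from this have "x \<noteq> 0"
      using x(2) by (auto simp: vec2_eq_iff)
    ultimately have "P = head"
      unfolding x(3) using pt_on_axis[of x] by (simp only: simp_thms)
    with x(4) show False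
      by contradiction
  qed
  have "club_vec x r \<in> W"
    unfolding W_def using x(1) by blast
  have "W \<inter> P = {0, club_vec x r}"
  proof (intro set_eqI iffI)
    fix v assume v: "v \<in> W \<inter> P"
    then obtain x' r' k where x': "v = club_vec x' r'" "\<not> E0 x'" "v = k *s club_vec x r"
      unfolding W_def x(3) Int_iff pt_iff by blast
    then have k: "x' = k * x" "snd_coord (E1 x') r' = k * snd_coord (E1 x) r"
      by (auto simp: club_vec_def vec2_eq_iff)
    show "v \<in> {0, club_vec x r}"
    proof (cases "k = 0")
      case True
      then show ?thesis
        using x'(3) by simp
    next
      case False
      then have nz': "E1 x' \<or> r'"
        using nz k(2) snd_coord_eq_0[of "E1 x'" r'] snd_coord_eq_0[of "E1 x" r] by auto
      \<comment> \<open>Applying \<open>E0\<close> to this proportionality leaves a 2 by 2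
        determinant over \<open>GF(2)\<close> in the bits of the second entries. It vanishes, and
        two nonzero proportional vectors over \<open>GF(2)\<close> are equal.\<close>
      have "x' * snd_coord (E1 x) r = x * snd_coord (E1 x') r'"
        unfolding k(2) by (subst k(1)) (simp only: ac_simps)
      then have "E0 (x' * snd_coord (E1 x) r) = E0 (x * snd_coord (E1 x') r')"
        by simp
      then have "(r \<and> E1 x') = (r' \<and> E1 x)"
        unfolding E_snd_coord using x(1) x'(2) by simp
      with nz nz' have "E1 x' = E1 x" "r' = r"
        by blast+
      with k(2) nz have "k = 1"
        using snd_coord_eq_0[of "E1 x" r] by auto
      then show ?thesis
        using x'(3) by simp
    qed
  next
    fix v assume "v \<in> {0, club_vec x r}"
    then show "v \<in> W \<inter> P"
      using W_0 self_in_pt vec.subspace_0[OF subspace_pt] \<open>club_vec x r \<in> W\<close> unfolding x(3) by blast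
  qed
  then show "weight W P = 1"
    unfolding x(3) using x(2) by (intro weight_eqI) simp
qed

text \<open>The point \<open>(k, 1)\<close> lies in the club iff some nonzero
  \<open>y = p + r * lam\<close> satisfies \<open>\<not> E0 (k * y)\<close> and
  \<open>E1 (k * y) = p\<close>. These are two homogeneous linear equations for
  \<open>(p, r)\<close> over \<open>GF(2)\<close> with determinant
  \<open>E0 k * E2 k + E1 k * (E1 k + 1)\<close>, whose last product is 0.\<close>

lemma club_C_affine: "club_C h lam = insert head {pt (vector [k, 1]) | k. \<not> (E0 k \<and> E2 k)}"
proof (intro set_eqI iffI)
  fix P assume "P \<in> club_C h lam"
  then obtain x r where x: "\<not> E0 x" "club_vec x r \<noteq> 0" "P = pt (club_vec x r)"
    unfolding club_C_eq linear_set_def W_def by blast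
  define y where "y = snd_coord (E1 x) r"
  show "P \<in> insert head {pt (vector [k, 1]) | k. \<not> (E0 k \<and> E2 k)}"
  proof (cases "y = 0")
    case True
    then have "P = pt (vector [x, 0])"
      unfolding x(3) club_vec_def y_def by simp
    moreover have "x \<noteq> 0"
      using x(2) True by (auto simp: club_vec_def vec2_eq_iff y_def)
    ultimately show ?thesis
      using pt_on_axis[of x] by (simp only: insertI1 simp_thms)
  next
    case False
    define k where "k = x / y"
    have k: "x = k * y"
      using False by (simp add: k_def)
    have "club_vec x r = y *s vector [k, 1]"
      unfolding club_vec_def y_def[symmetric] using k by (simp add: vec2_eq_iff mult.commute)
    then have "P = pt (vector [k, 1])"
      using x(3) pt_scale[OF False] by simp
    moreover have "E0 x \<longleftrightarrow> (E1 x \<and> E0 k) \<noteq> (r \<and> E1 k)" "E1 x \<longleftrightarrow> (E1 x \<and> E1 k) \<noteq> (r \<and> E2 k)"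
      using E_snd_coord[of k "E1 x" r] k unfolding y_def by simp_all
    moreover have "E1 x \<or> r"
      using False by (simp add: y_def snd_coord_eq_0)
    ultimately show ?thesis
      using x(1) by blast
  qed
next
  fix P assume P: "P \<in> insert head {pt (vector [k, 1]) | k. \<not> (E0 k \<and> E2 k)}"
  show "P \<in> club_C h lam"
  proof (cases "P = head")
    case True
    then show ?thesis
      using head_in_club by simp
  next
    case False
    then obtain k where k: "P = pt (vector [k, 1])" "\<not> (E0 k \<and> E2 k)"
      using P by blast
    \<comment> \<open>A nonzero solution of the two equations, found for each admissible choice of
      the bits of \<open>k\<close>.\<close>
    obtain p r where pr: "p \<or> r" "(p \<and> E0 k) = (r \<and> E1 k)" "((p \<and> E1 k) \<noteq> (r \<and> E2 k)) = p"
      using k(2) by (cases "E0 k"; cases "E1 k"; cases "E2 k") auto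
    define x where "x = k * snd_coord p r"
    have "\<not> E0 x" "E1 x = p"
      unfolding x_def E_snd_coord using pr by blast+
    then have cv: "club_vec x r = snd_coord p r *s vector [k, 1]"
      by (simp add: club_vec_def vec2_eq_iff x_def mult.commute)
    have nz: "snd_coord p r \<noteq> 0"
      using pr(1) by (simp add: snd_coord_eq_0)
    then have "club_vec x r \<noteq> 0"
      unfolding cv by (simp add: vec2_eq_iff)
    moreover have "P = pt (club_vec x r)"
      unfolding cv k(1) by (rule pt_scale[OF nz, symmetric])
    ultimately show ?thesis
      using \<open>\<not> E0 x\<close>
      unfolding club_C_eq linear_set_def W_def by blast
  qed
qed

section \<open>The complement of the arc on the translation line, and the equivalence\<close>

lemma to_PG1_pt: "to_PG1 (pt v) = pt (vector [v $ 1, v $ 3])"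
  for v :: "'a ^ 3"
proof -
  have "vector [(k *s v) $ 1, (k *s v) $ 3] = k *s (vector [v $ 1, v $ 3] :: 'a ^ 2)" for k
    by (simp add: vec2_eq_iff)
  then show ?thesis
    unfolding to_PG1_def set_eq_iff image_iff pt_iff Bex_def by metis
qed

lemma points_off_arc:
  "to_PG1 ` ({pt_N} \<union> (points_on (line_l lam) - arc_A0 h lam)) =
    insert head {pt (vector [x, 1]) | x. \<not> in_arc (lam, 1) x}"
proof -
  have nd: "normal_dir lam 1"
    by (simp add: normal_dir_def)
  have "points_on (line_l lam) - arc_A0 h lam \<subseteq> insert pt_N {afpt (lam, 1) x | x. \<not> in_arc (lam, 1) x}"
  proof
    fix P assume P: "P \<in> points_on (line_l lam) - arc_A0 h lam"
    then have "P \<in> pg_points"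
      by (simp add: points_on_def)
    from pg_points_afpt[OF this] show "P \<in> insert pt_N {afpt (lam, 1) x | x. \<not> in_arc (lam, 1) x}"
    proof
      assume "\<exists>y z x. normal_dir y z \<and> P = afpt (y, z) x"
      then obtain y z x where x: "normal_dir y z" "P = afpt (y, z) x"
        by blast
      then have "y = lam \<and> z = 1"
        using P afpt_on_nline[OF nd x(1)] unfolding line_l_eq by blast
      then have "P = afpt (lam, 1) x" "\<not> in_arc (lam, 1) x"
        using x P afpt_in_arcI by auto
      then show ?thesis
        by blast
    qed simp
  qed
  moreover have "{afpt (lam, 1) x | x. \<not> in_arc (lam, 1) x} \<subseteq> points_on (line_l lam) - arc_A0 h lam"
    using afpt_on_nline[OF nd nd] afpt_in_arc[OF nd] unfolding line_l_eq by auto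
  ultimately have "{pt_N} \<union> (points_on (line_l lam) - arc_A0 h lam) =
      insert pt_N {afpt (lam, 1) x | x. \<not> in_arc (lam, 1) x}"
    by blast
  moreover have "to_PG1 pt_N = head" "to_PG1 (afpt (lam, 1) x) = pt (vector [x, 1])" for x
    by (simp_all add: pt_N_def afpt_def to_PG1_pt)
  ultimately show ?thesis
    by (auto simp: image_iff) metis+
qed

text \<open>With \<open>k = lam * x / (1 + lam)\<close>, membership of \<open>x\<close> in the part of the arc on the line
  means \<open>E0 k\<close> and \<open>\<not> E2 k\<close>; adding \<open>lam ^ (h - 2)\<close> flips \<open>E2\<close>.\<close>

lemma pgl_equivalent_club:
  "pgl_equivalent (to_PG1 ` ({pt_N} \<union> (points_on (line_l lam) - arc_A0 h lam))) (club_C h lam)"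
proof -
  define m where "m = lam / (1 + lam)"
  define f where "f x = m * x + lam ^ (h - 2)" for x
  define M :: "'a ^ 2 ^ 2" where "M = vector [vector [m, lam ^ (h - 2)], vector [0, 1]]"
  have m: "m \<noteq> 0"
    using lam_distinct by (simp add: m_def)
  have M: "M *v v = vector [m * v $ 1 + lam ^ (h - 2) * v $ 2, v $ 2]" for v
    by (simp add: M_def vec2_eq_iff matrix_vector_mult_def sum_2)
  have "invertible M"
    by (simp add: invertible_det_nz det_2 M_def m)
  moreover have "pgl_map M head = head"
    using pt_on_axis[OF m] by (simp add: pgl_map_pt M)
  moreover have f: "pgl_map M (pt (vector [x, 1])) = pt (vector [f x, 1])" for x
    by (simp add: pgl_map_pt M f_def)
  have bits: "in_arc (lam, 1) x \<longleftrightarrow> E0 (f x) \<and> E2 (f x)" for x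
  proof -
    define u where "u = x / (1 + lam)"
    have "f x = lam * u + lam ^ (h - 2)"
      by (simp add: f_def m_def u_def)
    then have "E0 (f x) \<longleftrightarrow> E1 u" "E2 (f x) \<longleftrightarrow> \<not> E3 u"
      by (simp_all only: functional_simps h_bounds simp_thms)
    then show ?thesis
      unfolding in_arc_simps E_div_one_lam[of x, folded u_def] by blast
  qed
  \<comment> \<open>Surjectivity lets the image be described by a condition on all \<open>k\<close>,
    as in the affine form of the club.\<close>
  have "surj f"
  proof (rule surjI)
    show "f ((k - lam ^ (h - 2)) / m) = k" for k
      using m by (simp add: f_def)
  qed
  then have "{pt (vector [f x, 1]) | x. \<not> (E0 (f x) \<and> E2 (f x))} =
      {pt (vector [k, 1] :: 'a ^ 2) | k. \<not> (E0 k \<and> E2 k)}"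
    by (metis (no_types, opaque_lifting) surjD)
  moreover have "pgl_map M ` insert head {pt (vector [x, 1]) | x. \<not> in_arc (lam, 1) x} =
      insert (pgl_map M head) {pt (vector [f x, 1]) | x. \<not> (E0 (f x) \<and> E2 (f x))}"
    unfolding bits f[symmetric] by blast
  ultimately show ?thesis
    unfolding pgl_equivalent_def points_off_arc club_C_affine by (intro exI[of _ M]) simp
qed

end

theorem theorem3p12:
  fixes lam :: "'a::{field,finite}" and h :: nat and c :: "nat \<Rightarrow> bit"
  assumes "CARD('a) = 2 ^ h"
    and "primitive_element lam"
    and "f2_minpoly lam (monom 1 h + (\<Sum>i<h-2. monom (c i) i))"
  shows "km_arc (CARD('a) div 4) (arc_A0 h lam) \<and>
    nucleus (CARD('a) div 4) (arc_A0 h lam) pt_N \<and>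
    translation_line (arc_A0 h lam) (line_l lam) \<and>
    f2_club (h - 2) h (club_C h lam) \<and>
    pgl_equivalent (to_PG1 ` ({pt_N} \<union> (points_on (line_l lam) - arc_A0 h lam))) (club_C h lam)"
proof -
  interpret club_field lam h c
    using assms by unfold_locales
  show ?thesis
    using km_arc_A0 nucleus_A0 translation_line_A0 f2_club_C pgl_equivalent_club by blast
qed

end
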